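(* Let $0<\sigma<1$. There exists a constant $C_\sigma$, depending only on $\sigma$ (and not on $\alpha$ and $\beta$), such that for all $\alpha\ge-1/2$, all $\beta>-1/2$ and all $\theta,\varphi\in(0,\pi)$, the kernel $\mathcal{K}^{\alpha,\beta}_\sigma(\theta,\varphi)$ of the Jacobi fractional integral $(\mathcal{J}^{\alpha,\beta})^{-\sigma/2}$ satisfies $$0\le\mathcal{K}^{\alpha,\beta}_\sigma(\theta,\varphi)\le\frac{C_\sigma}{\left(\sin\frac\theta2\sin\frac\varphi2\right)^{\alpha+1/2}\left(\cos\frac\theta2\cos\frac\varphi2\right)^{\beta+1/2}}\left(\frac{1}{\beta+1/2}+\frac{1}{\left|\sin\frac{\theta-\varphi}{4}\right|^{1-\sigma}}\right).$$
   Context: For $\alpha,\beta>-1$ let $P_n^{(\alpha,\beta)}$ be the standard Jacobi polynomials, $$P_n^{(\alpha,\beta)}(x)=(1-x)^{-\alpha}(1+x)^{-\beta}\frac{(-1)^n}{2^nn!}\left(\frac{d}{dx}\right)^n\left\{(1-x)^{n+\alpha}(1+x)^{n+\beta}\right\},\quad x\in(-1,1).$$ The normalized trigonometric Jacobi polynomials are $\mathcal{P}_n^{(\alpha,\beta)}(\theta)=d_n^{\alpha,\beta}P_n^{(\alpha,\beta)}(\cos\theta)$ with $$d_n^{\alpha,\beta}=\left(\frac{(2n+\alpha+\beta+1)\Gamma(n+1)\Gamma(n+\alpha+\beta+1)}{\Gamma(n+\alpha+1)\Gamma(n+\beta+1)}\right)^{1/2}.$$ They form a complete orthonormal basis of $L^2((0,\pi),d\mu_{\alpha,\beta})$,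 where $d\mu_{\alpha,\beta}(\theta)=(\sin\frac\theta2)^{2\alpha+1}(\cos\frac\theta2)^{2\beta+1}\,d\theta$, and are eigenfunctions, with eigenvalues $\left(n+\frac{\alpha+\beta+1}{2}\right)^2$, of $$\mathcal{J}^{\alpha,\beta}=-\frac{d^2}{d\theta^2}-\frac{\alpha-\beta+(\alpha+\beta+1)\cos\theta}{\sin\theta}\frac{d}{d\theta}+\left(\frac{\alpha+\beta+1}{2}\right)^2.$$ The Jacobi--Poisson kernel is, for $t>0$, $$\mathcal{P}_t^{\alpha,\beta}(\theta,\varphi)=\sum_{n=0}^\infty e^{-t\left|n+\frac{\alpha+\beta+1}{2}\right|}\mathcal{P}_n^{(\alpha,\beta)}(\theta)\mathcal{P}_n^{(\alpha,\beta)}(\varphi),$$ and the fractional integral $(\mathcal{J}^{\alpha,\beta})^{-\sigma/2}$ (the operator with multiplier $(n+\frac{\alpha+\beta+1}{2})^{-\sigma}$ in the basis $\mathcal{P}_n^{(\alpha,\beta)}$) is the integral operator $(\mathcal{J}^{\alpha,\beta})^{-\sigma/2}f(\theta)=\int_0^\pi\mathcal{K}_\sigma^{\alpha,\beta}(\theta,\varphi)f(\varphi)\,d\mu_{\alpha,\beta}(\varphi)$ with kernel $$\mathcal{K}^{\alpha,\beta}_\sigma(\theta,\varphi)=\frac{1}{\Gamma(\sigma)}\int_0^\infty\mathcal{P}_t^{\alpha,\beta}(\theta,\varphi)\,\frac{dt}{t^{1-\sigma}}.$$ When $\theta=\varphi$ the right-hand side of the estimate is interpreted as $+\infty$. *)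

theory Defs
  imports "HOL-Analysis.Analysis"
begin

text \<open>Rodrigues' formula; meaningful for \<open>x \<in> (-1,1)\<close>, where the iterated derivative only
  sees the weight near \<open>x\<close>.\<close>

definition jacobi_P :: "real \<Rightarrow> real \<Rightarrow> nat \<Rightarrow> real \<Rightarrow> real" where
  "jacobi_P \<alpha> \<beta> n x =
     (1 - x) powr (-\<alpha>) * (1 + x) powr (-\<beta>) * ((-1) ^ n / (2 ^ n * fact n)) *
     (deriv ^^ n) (\<lambda>y. (1 - y) powr (real n + \<alpha>) * (1 + y) powr (real n + \<beta>)) x"

text \<open>For \<open>\<alpha> + \<beta> = -1\<close> and \<open>n = 0\<close> the numerator would have to be read as a limit; this
  does not arise when \<open>\<alpha> \<ge> -1/2\<close> and \<open>\<beta> > -1/2\<close>.\<close>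

definition jacobi_d :: "real \<Rightarrow> real \<Rightarrow> nat \<Rightarrow> real" where
  "jacobi_d \<alpha> \<beta> n =
     sqrt ((2 * real n + \<alpha> + \<beta> + 1) * Gamma (real n + 1) * Gamma (real n + \<alpha> + \<beta> + 1) /
           (Gamma (real n + \<alpha> + 1) * Gamma (real n + \<beta> + 1)))"

definition jacobi_trig :: "real \<Rightarrow> real \<Rightarrow> nat \<Rightarrow> real \<Rightarrow> real" where
  "jacobi_trig \<alpha> \<beta> n \<theta> = jacobi_d \<alpha> \<beta> n * jacobi_P \<alpha> \<beta> n (cos \<theta>)"

definition jacobi_poisson_kernel :: "real \<Rightarrow> real \<Rightarrow> real \<Rightarrow> real \<Rightarrow> real \<Rightarrow> real" where
  "jacobi_poisson_kernel \<alpha> \<beta> t \<theta> \<phi> =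
     (\<Sum>n. exp (- t * \<bar>real n + (\<alpha> + \<beta> + 1) / 2\<bar>) * jacobi_trig \<alpha> \<beta> n \<theta> * jacobi_trig \<alpha> \<beta> n \<phi>)"

text \<open>The Lebesgue integral of a real function with values in the extended reals, as the integral
  of the positive part minus that of the negative part. The integral does not exist when both are
  infinite; the value \<open>-\<infinity>\<close> chosen there makes the assertion that it is nonnegative fail,
  rather than hold by convention. (The Bochner integral would be \<open>0\<close> for every divergent
  integral, including those equal to \<open>+\<infinity>\<close>.)\<close>

definition ext_integral :: "'a measure \<Rightarrow> ('a \<Rightarrow> real) \<Rightarrow> ereal" where
  "ext_integral M f =
     (let p = (\<integral>\<^sup>+ x. ennreal (f x) \<partial>M); q = (\<integral>\<^sup>+ x. ennreal (- f x) \<partial>M)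
      in if p = \<infinity> \<and> q = \<infinity> then -\<infinity> else enn2ereal p - enn2ereal q)"

definition jacobi_frac_kernel :: "real \<Rightarrow> real \<Rightarrow> real \<Rightarrow> real \<Rightarrow> real \<Rightarrow> ereal" where
  "jacobi_frac_kernel \<sigma> \<alpha> \<beta> \<theta> \<phi> =
     ereal (1 / Gamma \<sigma>) *
     ext_integral (restrict_space lborel {0<..})
       (\<lambda>t. jacobi_poisson_kernel \<alpha> \<beta> t \<theta> \<phi> / t powr (1 - \<sigma>))"

end

theory Submission
  imports Defs "HOL-Complex_Analysis.Complex_Analysis" "HOL-Real_Asymp.Real_Asymp"
begin

text \<open>
  Put \<open>p = sin\<^sup>2 (\<theta>/2)\<close>, \<open>p' = sin\<^sup>2 (\<phi>/2)\<close>, \<open>a = sin (\<theta>/2) sin (\<phi>/2)\<close> and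
  \<open>b = cos (\<theta>/2) cos (\<phi>/2)\<close>. Watson's formula writes the product of two Jacobi polynomials as a
  terminating Appell series \<open>F\<^sub>4\<close> in \<open>a\<^sup>2 = p p'\<close> and \<open>b\<^sup>2 = (1-p)(1-p')\<close>; both sides solve the same
  second-order equation in \<open>p\<close>. Summing over the degree gives Bailey's formula: with
  \<open>z = 1 / cosh (t/2)\<close>, the Poisson kernel is \<open>sinh (t/2) z (z/2)\<^bsup>\<alpha>+\<beta>+1\<^esup>\<close> times a series in \<open>z\<^sup>2\<close>
  with nonnegative coefficients. So the kernel is nonnegative. By Legendre duplication and log-convexity of
  Gamma, \<open>4\<^sup>i \<Gamma>(i+\<alpha>+1) i!\<close> is at least a constant times \<open>2\<^bsup>-\<alpha>-1/2\<^esup> \<Gamma>(2i+\<alpha>+3/2)\<close>, uniformly in \<open>\<alpha>\<close>, so the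
  series is dominated by a binomial-like one, and after multiplication by the weights the kernel is at most
  \<open>9/(4\<pi>) sinh (t/2) / (cosh (t/2) - cos ((\<theta>-\<phi>)/2))\<close>, with no dependence on the parameters. For
  \<open>t \<ge> 2\<close> the factor \<open>z\<^bsup>\<alpha>+\<beta>+1\<^esup>\<close> and monotonicity of the series in \<open>z\<close> give exponential decay with rate
  \<open>(\<beta>+1/2)/4\<close>, whose integral is the term \<open>1/(\<beta>+1/2)\<close>.
\<close>

section \<open>Rodrigues' formula, the Jacobi equation and Watson's product formula\<close>

text \<open>Uniformity in the parameters shapes every estimate. Bailey's formula carries the factor
  \<open>2 powr (- (\<alpha> + \<beta> + 1)) / (Gamma (\<alpha> + 1) * Gamma (\<beta> + 1))\<close>;
  the duplication bound yields exactly its reciprocal, at a cost of 3 / (2 sqrt pi) per parameter,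
  whence 9 / (4 pi). Rearranging the double series proves Bailey's formula only for small r = exp (-
  t). It is then continued analytically in r, for which the Poisson series must already be known to
  converge for all r < 1; this is what the growth bounds are for. The quarter angle arises because a
  + b = cos ((\<theta> - \<phi>) / 2) and cosh (t / 2) - cos ((\<theta> - \<phi>) / 2) = 2 (sinh (t
  / 4)^2 + sin ((\<theta> - \<phi>) / 4)^2). With D = |sin ((\<theta> - \<phi>) / 4)| the weighted
  kernel is of size min (t / D^2, 1 / t) for small t, and integrating this against t^(\<sigma> - 1)
  gives D^(\<sigma> - 1). For large t the same bound only tends to a positive constant, against
  which t^(\<sigma> - 1) is not integrable; hence the separate argument there.\<close>

lemma iterated_deriv_jacobi_weight:
  fixes a b x :: real
  assumes "x \<in> {-1<..<1}"
  shows "(deriv ^^ k) (\<lambda>y. (1 - y) powr a * (1 + y) powr b) x =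
    fact k * (\<Sum>m\<le>k. (-1) ^ m * (a gchoose m) * (b gchoose (k - m)) *
      ((1 - x) powr (a - real m) * (1 + x) powr (b - real k + real m)))"
  using assms
proof (induction k arbitrary: x)
  case (Suc k)
  define U where "U m = (-1) ^ m * (a gchoose m) * (b gchoose (Suc k - m)) *
      ((1 - x) powr (a - real m) * (1 + x) powr (b - real (Suc k) + real m))" for m
  have x: "1 - x > 0" "1 + x > 0" using Suc.prems by auto
  have d: "((\<lambda>y. (-1) ^ m * (a gchoose m) * (b gchoose (k - m)) *
      ((1 - y) powr (a - real m) * (1 + y) powr (b - real k + real m))) has_real_derivative
      real (Suc m) * U (Suc m) + real (Suc k - m) * U m) (at x)" if "m \<le> k" for m
  proof -
    have a1: "real (Suc m) * (a gchoose Suc m) = (a - real m) * (a gchoose m)"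
      using gbinomial_mult_1[of a m] by (simp add: algebra_simps)
    have b1: "real (Suc k - m) * (b gchoose (Suc k - m)) = (b - real k + real m) * (b gchoose (k - m))"
      using gbinomial_mult_1[of b "k - m"] that by (simp add: algebra_simps Suc_diff_le of_nat_diff)
    have "((\<lambda>y. (-1) ^ m * (a gchoose m) * (b gchoose (k - m)) *
      ((1 - y) powr (a - real m) * (1 + y) powr (b - real k + real m))) has_real_derivative
      (-1) ^ m * (a gchoose m) * (b gchoose (k - m)) *
      (- ((a - real m) * (1 - x) powr (a - real m - 1)) * (1 + x) powr (b - real k + real m)
       + (1 - x) powr (a - real m) * ((b - real k + real m) * (1 + x) powr (b - real k + real m - 1)))) (at x)"
      using x by (auto intro!: derivative_eq_intros simp: algebra_simps)
    also have "(-1) ^ m * (a gchoose m) * (b gchoose (k - m)) *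
      (- ((a - real m) * (1 - x) powr (a - real m - 1)) * (1 + x) powr (b - real k + real m)
       + (1 - x) powr (a - real m) * ((b - real k + real m) * (1 + x) powr (b - real k + real m - 1)))
      = (-1) ^ Suc m * ((a - real m) * (a gchoose m)) * (b gchoose (k - m)) *
         ((1 - x) powr (a - real m - 1) * (1 + x) powr (b - real k + real m))
      + (-1) ^ m * (a gchoose m) * ((b - real k + real m) * (b gchoose (k - m))) *
         ((1 - x) powr (a - real m) * (1 + x) powr (b - real k + real m - 1))"
      by (simp add: algebra_simps)
    also have "\<dots> = real (Suc m) * U (Suc m) + real (Suc k - m) * U m"
      unfolding a1[symmetric] b1[symmetric] U_def using that
      by (simp add: algebra_simps)
    finally show ?thesis .
  qed
  have "((\<lambda>y. fact k * (\<Sum>m\<le>k. (-1) ^ m * (a gchoose m) * (b gchoose (k - m)) *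
      ((1 - y) powr (a - real m) * (1 + y) powr (b - real k + real m)))) has_real_derivative
      fact k * (\<Sum>m\<le>k. real (Suc m) * U (Suc m) + real (Suc k - m) * U m)) (at x)"
    by (intro DERIV_cmult DERIV_sum d) auto
  then have "((deriv ^^ k) (\<lambda>y. (1 - y) powr a * (1 + y) powr b) has_real_derivative
      fact k * (\<Sum>m\<le>k. real (Suc m) * U (Suc m) + real (Suc k - m) * U m)) (at x)"
    by (rule has_field_derivative_transform_within_open[where S="{-1<..<1}"])
       (use Suc in auto)
  then have "(deriv ^^ Suc k) (\<lambda>y. (1 - y) powr a * (1 + y) powr b) x =
      fact k * ((\<Sum>m\<le>k. real (Suc m) * U (Suc m)) + (\<Sum>m\<le>k. real (Suc k - m) * U m))"
    by (simp add: DERIV_imp_deriv sum.distrib)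
  \<comment> \<open>Both sums extend to m \<le> Suc k by a vanishing term, so the weights m and Suc
    k - m of \<open>U m\<close> add up to Suc k.\<close>
  also have "(\<Sum>m\<le>k. real (Suc m) * U (Suc m)) = (\<Sum>m\<le>Suc k. real m * U m)"
    by (subst sum.atMost_Suc_shift) simp
  also have "(\<Sum>m\<le>k. real (Suc k - m) * U m) = (\<Sum>m\<le>Suc k. real (Suc k - m) * U m)"
    by simp
  also have "(\<Sum>m\<le>Suc k. real m * U m) + (\<Sum>m\<le>Suc k. real (Suc k - m) * U m)
      = real (Suc k) * (\<Sum>m\<le>Suc k. U m)"
    unfolding sum.distrib[symmetric] sum_distrib_left
    by (rule sum.cong) (auto simp: algebra_simps of_nat_diff)
  finally show ?case by (simp add: U_def mult.assoc)
qed simp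

text \<open>The homogeneous part of degree \<open>k\<close> of Appell's \<open>F\<^sub>4\<close>. With \<open>X = -p\<close>, \<open>Y = 1 - p\<close> it is, up to a factor,
  the Jacobi polynomial \<open>P\<^sub>k(1 - 2p)\<close>.\<close>

definition jacobi_E :: "real \<Rightarrow> real \<Rightarrow> nat \<Rightarrow> real \<Rightarrow> real \<Rightarrow> real" where
  "jacobi_E \<alpha> \<beta> k X Y = (\<Sum>i\<le>k. X ^ i * Y ^ (k - i) /
     (pochhammer (\<alpha> + 1) i * fact i * (pochhammer (\<beta> + 1) (k - i) * fact (k - i))))"

lemma gbinomial_pochhammer_quotient:
  fixes a :: real
  assumes "a > -1" "i \<le> n"
  shows "(real n + a) gchoose (n - i) = pochhammer (a + 1) n / (pochhammer (a + 1) i * fact (n - i))"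
proof -
  have "pochhammer (a + 1) n = pochhammer (a + 1) i * pochhammer (a + 1 + real i) (n - i)"
    by (rule pochhammer_product[OF assms(2)])
  moreover have "pochhammer (a + 1) i > 0" by (rule pochhammer_pos) (use assms in auto)
  ultimately show ?thesis
    using assms by (simp add: gbinomial_pochhammer' of_nat_diff algebra_simps)
qed

lemma powr_cancel_nat:
  fixes x a :: real
  assumes "x > 0" "m \<le> n"
  shows "x powr (- a) * x powr (real n + a - real m) = x ^ (n - m)"
  using assms by (simp add: powr_add[symmetric] powr_realpow[symmetric] of_nat_diff)

text \<open>In Leibniz's sum the powers of \<open>1 - x = 2 * p\<close> and
  \<open>1 + x = 2 * (1 - p)\<close> combine with the weights of Rodrigues' formula into
  polynomials; reversing the index turns the binomials into the coefficients of
  \<open>jacobi_E\<close>.\<close>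

lemma jacobi_P_eq:
  assumes "\<alpha> > -1" "\<beta> > -1" "0 < p" "p < 1"
  shows "jacobi_P \<alpha> \<beta> n (1 - 2 * p) =
    pochhammer (\<alpha> + 1) n * pochhammer (\<beta> + 1) n * jacobi_E \<alpha> \<beta> n (- p) (1 - p)"
proof -
  have *: "(2 * p) powr (-\<alpha>) * (2 * (1 - p)) powr (-\<beta>) * ((-1) ^ n / (2 ^ n * fact n)) *
     (fact n * ((-1) ^ m * ((real n + \<alpha>) gchoose m) * ((real n + \<beta>) gchoose (n - m)) *
      ((2 * p) powr (real n + \<alpha> - real m) * (2 * (1 - p)) powr (real n + \<beta> - real n + real m))))
     = ((real n + \<alpha>) gchoose m) * ((real n + \<beta>) gchoose (n - m)) * (- p) ^ (n - m) * (1 - p) ^ m"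
    if "m \<le> n" for m
  proof -
    have p: "(2 * p) powr (-\<alpha>) * (2 * p) powr (real n + \<alpha> - real m) = (2 * p) ^ (n - m)"
      using assms that by (intro powr_cancel_nat) auto
    \<comment> \<open>The exponent is read as (n + m) + \<beta> - n, so that
      \<open>powr_cancel_nat\<close> leaves the power m.\<close>
    have q: "(2 * (1 - p)) powr (-\<beta>) * (2 * (1 - p)) powr (real n + \<beta> - real n + real m) = (2 * (1 - p)) ^ m"
      using powr_cancel_nat[of "2 * (1 - p)" n "n + m" \<beta>] assms that by (simp add: add.commute add.left_commute)
    have two: "(2::real) ^ n = 2 ^ (n - m) * 2 ^ m" using that by (simp flip: power_add)
    have sgn: "(-1::real) ^ n * (-1) ^ m = (-1) ^ (n - m)"
    proof -
      from that obtain d where "n = m + d" using le_Suc_ex by blast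
      then show ?thesis by (simp add: power_add mult_ac)
    qed
    have gen: "a1 * b1 * (s / (u * f)) * (f * (s' * G * H * (a2 * b2))) =
        G * H * ((s * s') * (a1 * a2) * (b1 * b2) / u)" if "f \<noteq> 0" for a1 b1 a2 b2 s s' u f G H :: real
      using that by (simp add: mult_ac)
    show ?thesis
      unfolding gen[OF fact_nonzero] p q sgn two power_mult_distrib power_minus[of p] by simp
  qed
  have "jacobi_P \<alpha> \<beta> n (1 - 2 * p) =
      (\<Sum>m\<le>n. ((real n + \<alpha>) gchoose m) * ((real n + \<beta>) gchoose (n - m)) * (- p) ^ (n - m) * (1 - p) ^ m)"
  proof -
    have x: "1 - 2 * p \<in> {-1<..<1}" "1 - (1 - 2 * p) = 2 * p" "1 + (1 - 2 * p) = 2 * (1 - p)"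
      using assms by auto
    show ?thesis
      unfolding jacobi_P_def iterated_deriv_jacobi_weight[OF x(1)] x(2,3) sum_distrib_left
      by (intro sum.cong[OF refl] *) simp
  qed
  also have "\<dots> = (\<Sum>i\<le>n. ((real n + \<alpha>) gchoose (n - i)) * ((real n + \<beta>) gchoose i) * (- p) ^ i * (1 - p) ^ (n - i))"
    by (rule sum.reindex_bij_witness[of _ "\<lambda>i. n - i" "\<lambda>i. n - i"]) auto
  also have "\<dots> = pochhammer (\<alpha> + 1) n * pochhammer (\<beta> + 1) n * jacobi_E \<alpha> \<beta> n (- p) (1 - p)"
    unfolding jacobi_E_def sum_distrib_left
  proof (rule sum.cong[OF refl])
    fix i assume "i \<in> {..n}"
    then have "i \<le> n" by simp
    have "(real n + \<beta>) gchoose i = pochhammer (\<beta> + 1) n / (pochhammer (\<beta> + 1) (n - i) * fact i)"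
      using gbinomial_pochhammer_quotient[of \<beta> "n - i" n] assms \<open>i \<le> n\<close> by simp
    then show "((real n + \<alpha>) gchoose (n - i)) * ((real n + \<beta>) gchoose i) * (- p) ^ i * (1 - p) ^ (n - i) =
      pochhammer (\<alpha> + 1) n * pochhammer (\<beta> + 1) n * ((- p) ^ i * (1 - p) ^ (n - i) /
     (pochhammer (\<alpha> + 1) i * fact i * (pochhammer (\<beta> + 1) (n - i) * fact (n - i))))"
      using gbinomial_pochhammer_quotient[of \<alpha> i n] assms \<open>i \<le> n\<close> by (simp add: mult_ac)
  qed
  finally show ?thesis .
qed

text \<open>The Jacobi differential operator in the variable \<open>p = (1 - x) / 2\<close>.\<close>

definition jacobi_op :: "real \<Rightarrow> real \<Rightarrow> real poly \<Rightarrow> real poly" where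
  "jacobi_op \<alpha> \<beta> f = [:0, 1, -1:] * pderiv (pderiv f) + [:\<alpha> + 1, - (\<alpha> + \<beta> + 2):] * pderiv f"

lemma jacobi_op_add: "jacobi_op \<alpha> \<beta> (f + g) = jacobi_op \<alpha> \<beta> f + jacobi_op \<alpha> \<beta> g"
  by (simp only: jacobi_op_def pderiv_add ring_distribs add_ac)

lemma jacobi_op_smult: "jacobi_op \<alpha> \<beta> (smult c f) = smult c (jacobi_op \<alpha> \<beta> f)"
  by (simp add: jacobi_op_def pderiv_smult smult_add_right)

lemma jacobi_op_sum: "jacobi_op \<alpha> \<beta> (\<Sum>i\<in>A. f i) = (\<Sum>i\<in>A. jacobi_op \<alpha> \<beta> (f i))"
proof (induction A rule: infinite_finite_induct)
  case (insert x A) then show ?case by (simp add: jacobi_op_add)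
qed (simp_all add: jacobi_op_def)

text \<open>Besides a multiple of the monomial itself only two terms of total degree i + j - 1
  appear, so the operator links each homogeneous sum only to itself and to the one of next lower
  degree.\<close>

lemma jacobi_op_monomial:
  "poly (jacobi_op \<alpha> \<beta> ([:0, 1:] ^ i * [:1, -1:] ^ j)) x =
     real i * (real i + \<alpha>) * x ^ (i - 1) * (1 - x) ^ j + real j * (real j + \<beta>) * x ^ i * (1 - x) ^ (j - 1)
     - real (i + j) * (real (i + j) + \<alpha> + \<beta> + 1) * x ^ i * (1 - x) ^ j"
proof -
  let ?X = "[:0, 1:] :: real poly" and ?Y = "[:1, -1:] :: real poly"
  define y x0 x1 x2 y0 y1 y2 where xy:
    "y = 1 - x" "x0 = x ^ i" "x1 = real i * x ^ (i - 1)" "x2 = real i * (real (i - 1) * x ^ (i - 1 - 1))"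
    "y0 = y ^ j" "y1 = real j * y ^ (j - 1)" "y2 = real j * (real (j - 1) * y ^ (j - 1 - 1))"
  \<comment> \<open>These relations survive truncated subtraction, because the coefficient vanishes
    whenever an exponent is cut off; the rest is ring algebra.\<close>
  have r: "x * x1 = real i * x0" "x * x2 = (real i - 1) * x1" "y * y1 = real j * y0" "y * y2 = (real j - 1) * y1"
    unfolding xy by (cases i; cases "i - 1"; cases j; cases "j - 1"; simp)+
  have X: "poly (pderiv (?X ^ n)) x = real n * x ^ (n - 1)" for n
    by (simp add: pderiv_power pderiv_pCons)
  have Y: "poly (pderiv (?Y ^ n)) x = - (real n * y ^ (n - 1))" for n
    by (simp add: pderiv_power pderiv_pCons xy)
  have pX: "pderiv (?X ^ n) = smult (real n) (?X ^ (n - 1))" for n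
    by (simp add: pderiv_power pderiv_pCons)
  have pY: "pderiv (?Y ^ n) = smult (- real n) (?Y ^ (n - 1))" for n
    by (simp add: pderiv_power pderiv_pCons)
  have d1: "poly (pderiv (?X ^ i * ?Y ^ j)) x = x1 * y0 - x0 * y1"
    by (simp add: pderiv_mult X Y xy algebra_simps)
  have d2: "poly (pderiv (pderiv (?X ^ i * ?Y ^ j))) x = x2 * y0 - 2 * x1 * y1 + x0 * y2"
    by (simp add: pderiv_mult pderiv_add pderiv_diff pX pY pderiv_smult xy algebra_simps)
  have yx: "x = 1 - y" by (simp add: xy)
  have "poly (jacobi_op \<alpha> \<beta> (?X ^ i * ?Y ^ j)) x =
     x * y * (x2 * y0 - 2 * x1 * y1 + x0 * y2) + ((\<alpha> + 1) - (\<alpha> + \<beta> + 2) * x) * (x1 * y0 - x0 * y1)"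
    unfolding jacobi_op_def poly_add poly_mult d1 d2 by (simp add: xy algebra_simps)
  also have "\<dots> = y * y0 * (x * x2) - 2 * (x * x1) * (y * y1) + x * x0 * (y * y2)
      + (\<alpha> + 1) * (x1 * y0 - x0 * y1) - (\<alpha> + \<beta> + 2) * (x * x1) * y0 + (\<alpha> + \<beta> + 2) * x0 * (y1 - y * y1)"
    by (simp add: yx algebra_simps)
  also have "\<dots> = (real i - 1) * y0 * (x1 - x * x1) - 2 * (x * x1) * (y * y1) + (real j - 1) * x0 * (y1 - y * y1)
      + (\<alpha> + 1) * (x1 * y0 - x0 * y1) - (\<alpha> + \<beta> + 2) * (x * x1) * y0 + (\<alpha> + \<beta> + 2) * x0 * (y1 - y * y1)"
    unfolding r(2) r(4) by (simp add: yx algebra_simps)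
  also have "\<dots> = (real i + \<alpha>) * x1 * y0 + (real j + \<beta>) * x0 * y1
      - real (i + j) * (real (i + j) + \<alpha> + \<beta> + 1) * x0 * y0"
    unfolding r(1) r(3) by (simp add: algebra_simps)
  finally show ?thesis by (simp add: xy algebra_simps)
qed

text \<open>One family serves both sides of Watson's formula: c = -1, d = 1 gives the Jacobi
  polynomial, and c = p', d = 1 - p' gives a homogeneous part of the Appell series as a polynomial
  in p.\<close>

definition jacobi_E_poly :: "real \<Rightarrow> real \<Rightarrow> nat \<Rightarrow> real \<Rightarrow> real \<Rightarrow> real poly" where
  "jacobi_E_poly \<alpha> \<beta> k c d = (\<Sum>i\<le>k. smult (c ^ i * d ^ (k - i) /
     (pochhammer (\<alpha> + 1) i * fact i * (pochhammer (\<beta> + 1) (k - i) * fact (k - i))))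
     ([:0, 1:] ^ i * [:1, -1:] ^ (k - i)))"

lemma poly_jacobi_E_poly:
  "poly (jacobi_E_poly \<alpha> \<beta> k c d) x = jacobi_E \<alpha> \<beta> k (c * x) (d * (1 - x))"
  by (simp add: jacobi_E_poly_def jacobi_E_def poly_sum power_mult_distrib mult_ac)

lemma jacobi_op_E_poly_0: "jacobi_op \<alpha> \<beta> (jacobi_E_poly \<alpha> \<beta> 0 c d) = 0"
  by (simp add: jacobi_E_poly_def jacobi_op_def)

lemma pochhammer_fact_Suc_quotient:
  fixes a :: real
  assumes "a > -1"
  shows "real (Suc i) * (real (Suc i) + a) / (pochhammer (a + 1) (Suc i) * fact (Suc i)) =
    1 / (pochhammer (a + 1) i * fact i)"
proof -
  have "pochhammer (a + 1) i > 0" "a + 1 + real i > 0"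
    using assms by (auto intro!: pochhammer_pos)
  moreover have "real (Suc i) + a = a + 1 + real i" by simp
  ultimately show ?thesis
    unfolding pochhammer_Suc fact_Suc of_nat_mult by (simp add: divide_simps del: of_nat_Suc)
qed

text \<open>The coefficients of \<open>jacobi_E\<close> absorb the factors i (i + \<alpha>) and j (j
  + \<beta>) produced by the operator, so the two lowering terms become c and d times the same sum
  of degree k. For c + d = 0 this is an eigenvalue equation; for c + d = 1 it is a recursion that
  can telescope.\<close>

lemma jacobi_op_E_poly_Suc:
  assumes "\<alpha> > -1" "\<beta> > -1"
  shows "jacobi_op \<alpha> \<beta> (jacobi_E_poly \<alpha> \<beta> (Suc k) c d) =
    smult (c + d) (jacobi_E_poly \<alpha> \<beta> k c d)
    - smult (real (Suc k) * (real (Suc k) + \<alpha> + \<beta> + 1)) (jacobi_E_poly \<alpha> \<beta> (Suc k) c d)"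
proof -
  define f where "f a i = 1 / (pochhammer (a + 1) i * fact i)" for a :: real and i
  define e where "e i j = f \<alpha> i * f \<beta> j" for i j :: nat
  have E: "jacobi_E_poly \<alpha> \<beta> k c d = (\<Sum>i\<le>k. smult (c ^ i * d ^ (k - i) * e i (k - i)) ([:0, 1:] ^ i * [:1, -1:] ^ (k - i)))" for k
    by (simp add: jacobi_E_poly_def e_def f_def)
  have f: "real (Suc i) * (real (Suc i) + a) * f a (Suc i) = f a i" if "a > -1" for a i
    by (simp only: f_def times_divide_eq_right mult_1_right pochhammer_fact_Suc_quotient[OF that])
  have e1: "real (Suc i) * (real (Suc i) + \<alpha>) * e (Suc i) j = e i j" for i j
    by (simp only: e_def mult.assoc[symmetric] f[OF assms(1)])
  have e2: "real (Suc j) * (real (Suc j) + \<beta>) * e i (Suc j) = e i j" for i j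
    by (simp only: e_def mult.left_commute[of _ "f \<alpha> i"] f[OF assms(2)])
  have "poly (jacobi_op \<alpha> \<beta> (jacobi_E_poly \<alpha> \<beta> (Suc k) c d)) x =
    poly (smult (c + d) (jacobi_E_poly \<alpha> \<beta> k c d)
    - smult (real (Suc k) * (real (Suc k) + \<alpha> + \<beta> + 1)) (jacobi_E_poly \<alpha> \<beta> (Suc k) c d)) x" for x
  proof -
    let ?N = "real (Suc k) * (real (Suc k) + \<alpha> + \<beta> + 1)"
    define T where "T i j = c ^ i * d ^ j * e i j * x ^ i * (1 - x) ^ j" for i j
    have S1: "(\<Sum>i\<le>Suc k. c ^ i * d ^ (Suc k - i) * e i (Suc k - i) * (real i * (real i + \<alpha>) * x ^ (i - 1) * (1 - x) ^ (Suc k - i)))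
        = c * (\<Sum>i\<le>k. T i (k - i))"
    proof -
      have "c ^ Suc i * d ^ (k - i) * e (Suc i) (k - i) * (real (Suc i) * (real (Suc i) + \<alpha>) * x ^ i * (1 - x) ^ (k - i)) = c * T i (k - i)" for i
        using e1[of i "k - i"] unfolding T_def by (simp add: mult_ac del: of_nat_Suc flip: e1[of i "k - i"])
      then show ?thesis unfolding sum.atMost_Suc_shift sum_distrib_left by (simp del: of_nat_Suc power_Suc)
    qed
    have S2: "(\<Sum>i\<le>Suc k. c ^ i * d ^ (Suc k - i) * e i (Suc k - i) * (real (Suc k - i) * (real (Suc k - i) + \<beta>) * x ^ i * (1 - x) ^ (Suc k - i - 1)))
        = d * (\<Sum>i\<le>k. T i (k - i))"
    proof -
      have "c ^ i * d ^ (Suc k - i) * e i (Suc k - i) * (real (Suc k - i) * (real (Suc k - i) + \<beta>) * x ^ i * (1 - x) ^ (Suc k - i - 1)) = d * T i (k - i)" if "i \<le> k" for i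
        using that e2[of "k - i" i] unfolding T_def by (simp add: Suc_diff_le mult_ac del: of_nat_Suc)
      then show ?thesis unfolding sum.atMost_Suc sum_distrib_left by simp
    qed
    have "poly (jacobi_op \<alpha> \<beta> (jacobi_E_poly \<alpha> \<beta> (Suc k) c d)) x =
      (\<Sum>i\<le>Suc k. c ^ i * d ^ (Suc k - i) * e i (Suc k - i) *
        (real i * (real i + \<alpha>) * x ^ (i - 1) * (1 - x) ^ (Suc k - i)
         + real (Suc k - i) * (real (Suc k - i) + \<beta>) * x ^ i * (1 - x) ^ (Suc k - i - 1)
         - ?N * x ^ i * (1 - x) ^ (Suc k - i)))"
      unfolding E jacobi_op_sum jacobi_op_smult poly_sum poly_smult jacobi_op_monomial
      by (rule sum.cong[OF refl]) (simp del: of_nat_Suc)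
    also have "\<dots> = c * (\<Sum>i\<le>k. T i (k - i)) + d * (\<Sum>i\<le>k. T i (k - i)) - ?N * (\<Sum>i\<le>Suc k. T i (Suc k - i))"
      unfolding S1[symmetric] S2[symmetric] sum_distrib_left[of ?N]
      unfolding sum.distrib[symmetric] sum_subtractf[symmetric]
      by (rule sum.cong[OF refl]) (simp only: T_def algebra_simps)
    also have "\<dots> = poly (smult (c + d) (jacobi_E_poly \<alpha> \<beta> k c d) - smult ?N (jacobi_E_poly \<alpha> \<beta> (Suc k) c d)) x"
      unfolding E poly_diff poly_smult poly_sum poly_mult poly_power T_def
      by (simp add: algebra_simps del: sum.atMost_Suc)
    finally show ?thesis .
  qed
  then show ?thesis by (subst poly_eq_poly_eq_iff[symmetric]) auto
qed

lemma coeff_jacobi_op: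
  "coeff (jacobi_op \<alpha> \<beta> f) m =
     real (Suc m) * (real (Suc m) + \<alpha>) * coeff f (Suc m) - real m * (real m + \<alpha> + \<beta> + 1) * coeff f m"
  unfolding jacobi_op_def
  by (cases m; cases "m - 1") (auto simp: coeff_pderiv algebra_simps)

text \<open>Comparing coefficients gives a two-term recursion whose leading factor is positive for
  \<alpha> > -1, so the value at 0 determines an eigenpolynomial. The cross-multiplied form also
  covers a vanishing value at 0.\<close>

lemma jacobi_op_eigen_unique:
  assumes "\<alpha> > -1" "jacobi_op \<alpha> \<beta> f = smult N f" "jacobi_op \<alpha> \<beta> g = smult N g"
  shows "smult (coeff g 0) f = smult (coeff f 0) g"
proof (rule poly_eqI)
  have rec: "coeff h (Suc m) = (N + real m * (real m + \<alpha> + \<beta> + 1)) / (real (Suc m) * (real (Suc m) + \<alpha>)) * coeff h m"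
    if "jacobi_op \<alpha> \<beta> h = smult N h" for h m
  proof -
    have "real (Suc m) * (real (Suc m) + \<alpha>) > 0" using assms(1) by simp
    moreover have "real (Suc m) * (real (Suc m) + \<alpha>) * coeff h (Suc m) =
        (N + real m * (real m + \<alpha> + \<beta> + 1)) * coeff h m"
      using arg_cong[OF that, of "\<lambda>p. coeff p m"] unfolding coeff_jacobi_op by (simp add: algebra_simps)
    ultimately show ?thesis by (simp add: field_simps del: of_nat_Suc)
  qed
  fix m show "coeff (smult (coeff g 0) f) m = coeff (smult (coeff f 0) g) m"
    by (induction m) (simp_all add: rec[OF assms(2)] rec[OF assms(3)] del: of_nat_Suc)
qed

text \<open>A terminating \<open>F\<^sub>4\<close>: the summand vanishes for \<open>k > n\<close>.\<close>

definition jacobi_F :: "real \<Rightarrow> real \<Rightarrow> nat \<Rightarrow> real \<Rightarrow> real \<Rightarrow> real" where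
  "jacobi_F \<alpha> \<beta> n X Y = (\<Sum>k\<le>n. pochhammer (- real n) k * pochhammer (real n + \<alpha> + \<beta> + 1) k * jacobi_E \<alpha> \<beta> k X Y)"

lemma jacobi_op_E_poly_eigen:
  assumes "\<alpha> > -1" "\<beta> > -1"
  shows "jacobi_op \<alpha> \<beta> (jacobi_E_poly \<alpha> \<beta> n (-1) 1) =
    smult (- (real n * (real n + \<alpha> + \<beta> + 1))) (jacobi_E_poly \<alpha> \<beta> n (-1) 1)"
  by (cases n) (simp_all add: jacobi_op_E_poly_0 jacobi_op_E_poly_Suc[OF assms] del: of_nat_Suc)

text \<open>Here c + d = 1. The coefficients satisfy \<open>A (Suc k) = (l k - l n) * A k\<close>
  with l k = k (k + \<alpha> + \<beta> + 1), so shifting the lowering terms replaces the eigenvalue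
  of each degree by that of degree n.\<close>

lemma jacobi_op_F_poly_eigen:
  fixes p :: real and n :: nat
  assumes "\<alpha> > -1" "\<beta> > -1"
  defines "A \<equiv> \<lambda>k. pochhammer (- real n) k * pochhammer (real n + \<alpha> + \<beta> + 1) k"
  defines "F \<equiv> \<Sum>k\<le>n. smult (A k) (jacobi_E_poly \<alpha> \<beta> k p (1 - p))"
  shows "jacobi_op \<alpha> \<beta> F = smult (- (real n * (real n + \<alpha> + \<beta> + 1))) F"
proof -
  let ?E = "\<lambda>k. jacobi_E_poly \<alpha> \<beta> k p (1 - p)" and ?l = "\<lambda>k. real k * (real k + \<alpha> + \<beta> + 1)"
  have A_Suc: "A (Suc k) = (?l k - ?l n) * A k" for k
    unfolding A_def pochhammer_Suc by (simp add: algebra_simps)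
  have "A (Suc n) = 0" unfolding A_Suc by simp
  have "jacobi_op \<alpha> \<beta> F = (\<Sum>k\<le>n. smult (A k) (jacobi_op \<alpha> \<beta> (?E k)))"
    by (simp add: F_def jacobi_op_sum jacobi_op_smult)
  also have "\<dots> = (\<Sum>k\<le>Suc n. smult (A k) (jacobi_op \<alpha> \<beta> (?E k)))"
    using \<open>A (Suc n) = 0\<close> by simp
  also have "\<dots> = (\<Sum>k\<le>n. smult (A (Suc k)) (jacobi_op \<alpha> \<beta> (?E (Suc k))))"
    by (subst sum.atMost_Suc_shift) (simp add: jacobi_op_E_poly_0)
  also have "\<dots> = (\<Sum>k\<le>n. smult (A (Suc k)) (?E k)) - (\<Sum>k\<le>n. smult (A (Suc k) * ?l (Suc k)) (?E (Suc k)))"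
    by (simp add: jacobi_op_E_poly_Suc[OF assms(1,2)] smult_diff_right sum_subtractf del: of_nat_Suc)
  also have "(\<Sum>k\<le>n. smult (A (Suc k) * ?l (Suc k)) (?E (Suc k))) = (\<Sum>k\<le>Suc n. smult (A k * ?l k) (?E k))"
    by (simp only: sum.atMost_Suc_shift[of _ n]) simp
  also have "\<dots> = (\<Sum>k\<le>n. smult (A k * ?l k) (?E k))"
    using \<open>A (Suc n) = 0\<close> by simp
  also have "(\<Sum>k\<le>n. smult (A (Suc k)) (?E k)) - (\<Sum>k\<le>n. smult (A k * ?l k) (?E k)) =
      (\<Sum>k\<le>n. smult (- ?l n) (smult (A k) (?E k)))"
    unfolding sum_subtractf[symmetric] smult_diff_left[symmetric] smult_smult
    by (rule sum.cong[OF refl]) (simp add: A_Suc algebra_simps)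
  also have "\<dots> = smult (- ?l n) F"
    unfolding F_def by (rule poly_eqI) (simp add: coeff_sum sum_distrib_left sum_negf mult.assoc)
  finally show ?thesis .
qed

lemma jacobi_E_01: "\<alpha> > -1 \<Longrightarrow> \<beta> > -1 \<Longrightarrow> jacobi_E \<alpha> \<beta> n 0 1 = 1 / (pochhammer (\<beta> + 1) n * fact n)"
  by (simp add: jacobi_E_def power_0_left if_distrib[of "\<lambda>x. x * _"] if_distrib[of "\<lambda>x. x / _"] cong: if_cong)

lemma jacobi_E_m10: "\<alpha> > -1 \<Longrightarrow> \<beta> > -1 \<Longrightarrow> jacobi_E \<alpha> \<beta> n (-1) 0 = (-1) ^ n / (pochhammer (\<alpha> + 1) n * fact n)"
proof -
  have "(\<Sum>i\<le>n. (-1) ^ i * 0 ^ (n - i) / (pochhammer (\<alpha> + 1) i * fact i * (pochhammer (\<beta> + 1) (n - i) * fact (n - i))))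
      = (\<Sum>i\<le>n. if i = n then (-1) ^ n / (pochhammer (\<alpha> + 1) n * fact n) else 0)"
    by (rule sum.cong) auto
  then show ?thesis by (simp add: jacobi_E_def)
qed

text \<open>Both sides are eigenfunctions in \<open>p\<close>, and the right-hand side is symmetric in \<open>p\<close> and \<open>p'\<close>, so they agree up
  to a constant, which is read off at \<open>p = 1\<close>, \<open>p' = 0\<close>, where only the summand \<open>k = 0\<close> survives.\<close>

lemma jacobi_E_product:
  assumes "\<alpha> > -1" "\<beta> > -1"
  shows "jacobi_E \<alpha> \<beta> n (- p) (1 - p) * jacobi_E \<alpha> \<beta> n (- p') (1 - p') =
    (-1) ^ n / (pochhammer (\<alpha> + 1) n * pochhammer (\<beta> + 1) n * (fact n)\<^sup>2) *
    jacobi_F \<alpha> \<beta> n (p * p') ((1 - p) * (1 - p'))"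
proof -
  define J where "J p = jacobi_E \<alpha> \<beta> n (- p) (1 - p)" for p
  define F where "F p p' = jacobi_F \<alpha> \<beta> n (p * p') ((1 - p) * (1 - p'))" for p p'
  have FJ: "J 0 * F p p' = F 0 p' * J p" for p p'
  proof -
    let ?J = "jacobi_E_poly \<alpha> \<beta> n (-1) 1"
    let ?F = "\<Sum>k\<le>n. smult (pochhammer (- real n) k * pochhammer (real n + \<alpha> + \<beta> + 1) k) (jacobi_E_poly \<alpha> \<beta> k p' (1 - p'))"
    have F: "poly ?F x = F x p'" for x
      by (simp add: F_def jacobi_F_def poly_sum poly_jacobi_E_poly mult.commute)
    have J: "poly ?J x = J x" for x
      by (simp add: J_def poly_jacobi_E_poly)
    have "smult (coeff ?J 0) ?F = smult (coeff ?F 0) ?J"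
      using assms jacobi_op_F_poly_eigen jacobi_op_E_poly_eigen by (intro jacobi_op_eigen_unique)
    from arg_cong[OF this, of "\<lambda>f. poly f p"] show ?thesis
      unfolding poly_smult poly_0_coeff_0[symmetric] F J .
  qed
  have sym: "F p p' = F p' p" for p p'
    by (simp add: F_def mult.commute)
  have "F 1 0 = 1"
  proof -
    have "F 1 0 = (\<Sum>k\<le>n. if k = 0 then 1 else 0)"
      unfolding F_def jacobi_F_def
      by (rule sum.cong) (auto simp: jacobi_E_def power_0_left intro!: sum.neutral)
    then show ?thesis by simp
  qed
  \<comment> \<open>Separation in p, then by symmetry in p', leaves only the unknown constant
    \<open>F 0 0\<close>, which evaluation at (1, 0) eliminates.\<close>
  have "J 0 * J 0 * F p p' = J 0 * F p' 0 * J p" for p p'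
    unfolding sym[of p' 0] FJ[of p p', symmetric] mult.assoc ..
  moreover have "J 0 * F p' 0 = F 0 0 * J p'" for p'
    by (rule FJ)
  ultimately have FF: "J 0 * J 0 * F p p' = F 0 0 * J p * J p'" for p p'
    by (simp add: mult_ac)
  have pos: "pochhammer (\<alpha> + 1) n > 0" "pochhammer (\<beta> + 1) n > 0"
    using assms by (auto intro!: pochhammer_pos)
  have J0: "J 0 = 1 / (pochhammer (\<beta> + 1) n * fact n)"
    using jacobi_E_01[OF assms] by (simp add: J_def)
  have J1: "J 1 = (-1) ^ n / (pochhammer (\<alpha> + 1) n * fact n)"
    using jacobi_E_m10[OF assms] by (simp add: J_def)
  have "J 0 \<noteq> 0" "J 1 \<noteq> 0" using pos by (auto simp: J0 J1)
  have "F 0 0 * J 1 = J 0" using FF[of 1 0] \<open>F 1 0 = 1\<close> \<open>J 0 \<noteq> 0\<close> by simp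
  then have "J 0 * J 1 * F p p' = J p * J p'"
  proof -
    have "J 0 * (J 0 * J 1 * F p p') = (J 0 * J 0 * F p p') * J 1" by (simp add: mult_ac)
    also have "\<dots> = (F 0 0 * J 1) * (J p * J p')"
      unfolding FF by (simp add: mult_ac)
    finally have "J 0 * (J 0 * J 1 * F p p') = J 0 * (J p * J p')"
      unfolding \<open>F 0 0 * J 1 = J 0\<close> .
    then show ?thesis using \<open>J 0 \<noteq> 0\<close> by simp
  qed
  then have "J p * J p' = J 0 * J 1 * F p p'" ..
  also have "\<dots> = (-1) ^ n / (pochhammer (\<alpha> + 1) n * pochhammer (\<beta> + 1) n * (fact n)\<^sup>2) * F p p'"
    by (simp add: J0 J1 power2_eq_square mult_ac)
  finally show ?thesis by (simp add: J_def F_def)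
qed

section \<open>Growth of the Jacobi polynomials\<close>

text \<open>Sonin's function \<open>P\<^sup>2 + p(1-p) P'\<^sup>2 / N\<close> has derivative \<open>P'\<^sup>2/N (2(\<alpha>+\<beta>+1)p - (2\<alpha>+1))\<close>, hence first decreases and then
  increases.\<close>

lemma jacobi_E_bound:
  assumes ab: "\<alpha> \<ge> -1/2" "\<beta> \<ge> -1/2" "\<alpha> + \<beta> + 1 > 0" and p: "0 \<le> p" "p \<le> 1"
  shows "(jacobi_E \<alpha> \<beta> n (- p) (1 - p))\<^sup>2 \<le> max ((jacobi_E \<alpha> \<beta> n 0 1)\<^sup>2) ((jacobi_E \<alpha> \<beta> n (-1) 0)\<^sup>2)"
proof (cases "n = 0")
  case True then show ?thesis by (simp add: jacobi_E_def)
next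
  case False
  define N where "N = real n * (real n + \<alpha> + \<beta> + 1)"
  define c where "c = 1 / N"
  define P where "P = jacobi_E_poly \<alpha> \<beta> n (-1) 1"
  define f where "f x = (poly P x)\<^sup>2 + x * (1 - x) * (poly (pderiv P) x)\<^sup>2 * c" for x
  define g where "g x = (poly (pderiv P) x)\<^sup>2 * c * (2 * (\<alpha> + \<beta> + 1) * x - (2 * \<alpha> + 1))" for x
  have N: "N > 0" unfolding N_def using False ab by (intro mult_pos_pos) auto
  then have c: "c > 0" "N * c = 1" by (auto simp: c_def)
  have P: "poly P x = jacobi_E \<alpha> \<beta> n (- x) (1 - x)" for x by (simp add: P_def poly_jacobi_E_poly)
  have ode: "x * (1 - x) * poly (pderiv (pderiv P)) x =
      - ((\<alpha> + 1 - (\<alpha> + \<beta> + 2) * x) * poly (pderiv P) x) - N * poly P x" for x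
    using arg_cong[OF jacobi_op_E_poly_eigen[of \<alpha> \<beta> n], of "\<lambda>f. poly f x"] ab
    unfolding P_def[symmetric] N_def[symmetric] jacobi_op_def by (simp add: algebra_simps)
  have df: "(f has_real_derivative g x) (at x)" for x
  proof -
    have "(f has_real_derivative 2 * poly P x * poly (pderiv P) x +
        ((1 - 2 * x) * (poly (pderiv P) x)\<^sup>2
          + 2 * poly (pderiv P) x * (x * (1 - x) * poly (pderiv (pderiv P)) x)) * c) (at x)"
      unfolding f_def
      by (auto intro!: derivative_eq_intros poly_DERIV simp: power2_eq_square algebra_simps)
    \<comment> \<open>The differential equation replaces p (1 - p) P'', and since N c = 1 the terms
      in P P' cancel.\<close>
    also have "2 * poly P x * poly (pderiv P) x + ((1 - 2 * x) * (poly (pderiv P) x)\<^sup>2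
          + 2 * poly (pderiv P) x * (x * (1 - x) * poly (pderiv (pderiv P)) x)) * c = g x"
    proof -
      have "2 * poly P x * poly (pderiv P) x = 2 * poly P x * poly (pderiv P) x * (N * c)" using c by simp
      then show ?thesis unfolding ode g_def by (simp add: power2_eq_square algebra_simps)
    qed
    finally show ?thesis .
  qed
  have "f p \<le> max (f 0) (f 1)"
  proof (cases "2 * (\<alpha> + \<beta> + 1) * p \<le> 2 * \<alpha> + 1")
    case True
    have "g x \<le> 0" if "x \<le> p" for x
    proof -
      have "2 * (\<alpha> + \<beta> + 1) * x \<le> 2 * (\<alpha> + \<beta> + 1) * p"
        using that ab by (intro mult_left_mono) auto
      then show ?thesis unfolding g_def using True c by (intro mult_nonneg_nonpos) auto
    qed
    then have "f 0 \<ge> f p" using df p by (intro DERIV_nonpos_imp_nonincreasing[of 0 p f]) blast+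
    then show ?thesis by simp
  next
    case False
    have "g x \<ge> 0" if "x \<ge> p" for x
    proof -
      have "2 * (\<alpha> + \<beta> + 1) * x \<ge> 2 * (\<alpha> + \<beta> + 1) * p"
        using that ab by (intro mult_left_mono) auto
      then show ?thesis unfolding g_def using False c by (intro mult_nonneg_nonneg) auto
    qed
    then have "f p \<le> f 1" using df p by (intro DERIV_nonneg_imp_nondecreasing[of p 1 f]) blast+
    then show ?thesis by simp
  qed
  moreover have "(poly P p)\<^sup>2 \<le> f p" unfolding f_def using p c by simp
  ultimately show ?thesis by (simp add: f_def P)
qed

lemma pos_notin_nonpos_Ints: "(x::real) > 0 \<Longrightarrow> x \<notin> \<int>\<^sub>\<le>\<^sub>0"
  by (auto elim!: nonpos_Ints_cases)

text \<open>Up to Gamma factors this is the squared normalised polynomial at the endpoint p = 0;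
  exchanging \<alpha> and \<beta> gives p = 1. Consecutive coefficients have ratio tending to 1, so
  the radius of convergence is 1.\<close>

lemma summable_jacobi_majorant:
  fixes \<alpha> \<beta> r :: real
  assumes "\<alpha> > -1" "\<beta> > -1" "\<alpha> + \<beta> + 1 > 0" "\<bar>r\<bar> < 1"
  shows "summable (\<lambda>n. (2 * real n + \<alpha> + \<beta> + 1) * Gamma (real n + \<alpha> + \<beta> + 1) * pochhammer (\<alpha> + 1) n /
     (fact n * pochhammer (\<beta> + 1) n) * r ^ n)"
proof -
  define f where "f n = (2 * real n + \<alpha> + \<beta> + 1) * Gamma (real n + \<alpha> + \<beta> + 1) * pochhammer (\<alpha> + 1) n /
     (fact n * pochhammer (\<beta> + 1) n)" for n :: nat
  have pos: "f n > 0" for n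
    unfolding f_def using assms
    by (intro divide_pos_pos mult_pos_pos pochhammer_pos Gamma_real_pos) (auto intro: add_nonneg_pos)
  have ratio: "f n / f (Suc n) = (2 * real n + \<alpha> + \<beta> + 1) * (real n + 1) * (real n + \<beta> + 1) /
     ((2 * real n + \<alpha> + \<beta> + 3) * (real n + \<alpha> + \<beta> + 1) * (real n + \<alpha> + 1))" for n
  proof -
    define G where "G = Gamma (real n + \<alpha> + \<beta> + 1)"
    have "Gamma (real (Suc n) + \<alpha> + \<beta> + 1) = (real n + \<alpha> + \<beta> + 1) * G"
      unfolding G_def using Gamma_plus1[OF pos_notin_nonpos_Ints, of "real n + \<alpha> + \<beta> + 1"] assms by (simp add: add_ac)
    moreover have "G > 0" "pochhammer (\<alpha> + 1) n > 0" "pochhammer (\<beta> + 1) n > 0"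
      "real n + \<alpha> + \<beta> + 1 > 0" "\<alpha> + 1 + real n > 0" "\<beta> + 1 + real n > 0" "2 * real n + \<alpha> + \<beta> + 3 > 0"
      unfolding G_def using assms by (auto intro!: Gamma_real_pos pochhammer_pos)
    ultimately show ?thesis
      unfolding f_def pochhammer_Suc fact_Suc G_def[symmetric] by (simp add: divide_simps) (simp add: algebra_simps)
  qed
  have "(\<lambda>n. norm (f n) / norm (f (Suc n))) \<longlonglongrightarrow> 1"
    using pos by (simp add: less_imp_le abs_of_nonneg ratio) real_asymp
  then have "conv_radius f = 1"
    by (intro conv_radius_ratio_limit_nonzero[where c=1]) auto
  then show ?thesis
    unfolding f_def[symmetric] using assms(4) by (intro summable_in_conv_radius) auto
qed

text \<open>For X = a^2 and Y = b^2 this is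
  \<open>Gamma (\<alpha> + 1) * Gamma (\<beta> + 1)\<close> times the product of the two normalised
  polynomials of degree n, rewritten by Watson's formula.\<close>

definition jacobi_coeff :: "real \<Rightarrow> real \<Rightarrow> nat \<Rightarrow> real \<Rightarrow> real \<Rightarrow> real" where
  "jacobi_coeff \<alpha> \<beta> n X Y = (-1) ^ n * (2 * real n + \<alpha> + \<beta> + 1) * Gamma (real n + \<alpha> + \<beta> + 1) / fact n * jacobi_F \<alpha> \<beta> n X Y"

lemma jacobi_trig_product:
  assumes ab: "\<alpha> > -1" "\<beta> > -1" "\<alpha> + \<beta> + 1 > 0" and "\<theta> \<in> {0<..<pi}" "\<phi> \<in> {0<..<pi}"
  defines "p \<equiv> (sin (\<theta> / 2))\<^sup>2" and "p' \<equiv> (sin (\<phi> / 2))\<^sup>2"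
  shows "jacobi_trig \<alpha> \<beta> n \<theta> * jacobi_trig \<alpha> \<beta> n \<phi> =
     (2 * real n + \<alpha> + \<beta> + 1) * Gamma (real n + \<alpha> + \<beta> + 1) * fact n *
     pochhammer (\<alpha> + 1) n * pochhammer (\<beta> + 1) n / (Gamma (\<alpha> + 1) * Gamma (\<beta> + 1)) *
     (jacobi_E \<alpha> \<beta> n (- p) (1 - p) * jacobi_E \<alpha> \<beta> n (- p') (1 - p'))"
proof -
  have P: "jacobi_P \<alpha> \<beta> n (cos x) = pochhammer (\<alpha> + 1) n * pochhammer (\<beta> + 1) n *
      jacobi_E \<alpha> \<beta> n (- (sin (x / 2))\<^sup>2) (1 - (sin (x / 2))\<^sup>2)" if x: "x \<in> {0<..<pi}" for x
  proof -
    have "sin (x / 2) > 0" using x by (intro sin_gt_zero) auto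
    then have s: "(sin (x / 2))\<^sup>2 > 0" by simp
    have "cos (x / 2) > 0" using x by (intro cos_gt_zero_pi) auto
    then have "(cos (x / 2))\<^sup>2 > 0" by simp
    then have "(sin (x / 2))\<^sup>2 < 1" unfolding sin_squared_eq by linarith
    moreover have "cos x = 1 - 2 * (sin (x / 2))\<^sup>2" using cos_double_sin[of "x / 2"] by simp
    ultimately show ?thesis using jacobi_P_eq[OF ab(1,2) s] by (simp only:)
  qed
  have G: "Gamma (real n + a + 1) = Gamma (a + 1) * pochhammer (a + 1) n" if "a > -1" for a
  proof -
    have "Gamma (a + 1) \<noteq> 0" using that Gamma_real_pos[of "a + 1"] by linarith
    moreover have "pochhammer (a + 1) n = Gamma (a + 1 + real n) / Gamma (a + 1)"
      using that by (intro pochhammer_Gamma pos_notin_nonpos_Ints) auto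
    ultimately show ?thesis by (metis add.assoc add.commute nonzero_eq_divide_eq mult.commute)
  qed
  have pos: "Gamma (\<alpha> + 1) > 0" "Gamma (\<beta> + 1) > 0" "pochhammer (\<alpha> + 1) n > 0" "pochhammer (\<beta> + 1) n > 0"
      "Gamma (real n + \<alpha> + \<beta> + 1) > 0"
    using ab by (auto intro!: Gamma_real_pos pochhammer_pos)
  have "(jacobi_d \<alpha> \<beta> n)\<^sup>2 = (2 * real n + \<alpha> + \<beta> + 1) * fact n * Gamma (real n + \<alpha> + \<beta> + 1) /
           (Gamma (\<alpha> + 1) * pochhammer (\<alpha> + 1) n * (Gamma (\<beta> + 1) * pochhammer (\<beta> + 1) n))"
    unfolding jacobi_d_def G[OF ab(1)] G[OF ab(2)]
    using pos ab by (subst real_sqrt_pow2) (auto simp: Gamma_fact add_ac intro!: divide_nonneg_nonneg mult_nonneg_nonneg)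
  note d = this
  let ?J = "jacobi_E \<alpha> \<beta> n (- p) (1 - p)" and ?J' = "jacobi_E \<alpha> \<beta> n (- p') (1 - p')"
  have "jacobi_trig \<alpha> \<beta> n \<theta> * jacobi_trig \<alpha> \<beta> n \<phi> =
      (jacobi_d \<alpha> \<beta> n)\<^sup>2 * ((pochhammer (\<alpha> + 1) n * pochhammer (\<beta> + 1) n)\<^sup>2 * (?J * ?J'))"
    unfolding jacobi_trig_def P[OF assms(4)] P[OF assms(5)] p_def[symmetric] p'_def[symmetric]
    by (simp add: power2_eq_square mult_ac)
  then show ?thesis
    unfolding d using pos by (simp add: power2_eq_square divide_simps mult_ac)
qed

lemma jacobi_trig_product_eq_coeff:
  assumes ab: "\<alpha> > -1" "\<beta> > -1" "\<alpha> + \<beta> + 1 > 0" and "\<theta> \<in> {0<..<pi}" "\<phi> \<in> {0<..<pi}"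
  shows "jacobi_trig \<alpha> \<beta> n \<theta> * jacobi_trig \<alpha> \<beta> n \<phi> =
     jacobi_coeff \<alpha> \<beta> n ((sin (\<theta> / 2) * sin (\<phi> / 2))\<^sup>2) ((cos (\<theta> / 2) * cos (\<phi> / 2))\<^sup>2) / (Gamma (\<alpha> + 1) * Gamma (\<beta> + 1))"
proof -
  have pos: "pochhammer (\<alpha> + 1) n > 0" "pochhammer (\<beta> + 1) n > 0"
    using ab by (auto intro!: pochhammer_pos)
  have c: "1 - (sin x)\<^sup>2 = (cos x)\<^sup>2" for x :: real by (simp add: cos_squared_eq)
  show ?thesis
    unfolding jacobi_trig_product[OF assms] jacobi_E_product[OF ab(1,2)]
    unfolding jacobi_coeff_def c power_mult_distrib[symmetric]
    using pos by (simp add: power2_eq_square mult_ac)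
qed

text \<open>Sonin's bound reduces both factors to their endpoint values. Convergence for every r < 1
  gives \<open>suminf\<close> its intended meaning in the Poisson kernel and makes that side
  holomorphic in the whole unit disc.\<close>

lemma summable_jacobi_trig_product:
  assumes ab: "\<alpha> \<ge> -1/2" "\<beta> \<ge> -1/2" "\<alpha> + \<beta> + 1 > 0" and "\<theta> \<in> {0<..<pi}" "\<phi> \<in> {0<..<pi}"
    and r: "0 \<le> r" "r < 1"
  shows "summable (\<lambda>n. jacobi_trig \<alpha> \<beta> n \<theta> * jacobi_trig \<alpha> \<beta> n \<phi> * r ^ n)"
proof -
  have ab': "\<alpha> > -1" "\<beta> > -1" using ab by auto
  define A where "A \<alpha> \<beta> n = (2 * real n + \<alpha> + \<beta> + 1) * Gamma (real n + \<alpha> + \<beta> + 1) * pochhammer (\<alpha> + 1) n /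
     (fact n * pochhammer (\<beta> + 1) n)" for \<alpha> \<beta> :: real and n :: nat
  let ?c = "Gamma (\<alpha> + 1) * Gamma (\<beta> + 1)"
  have "summable (\<lambda>n. (A \<alpha> \<beta> n * r ^ n + A \<beta> \<alpha> n * r ^ n) / ?c)"
    unfolding A_def using summable_jacobi_majorant[of \<alpha> \<beta> r] summable_jacobi_majorant[of \<beta> \<alpha> r] ab r
    by (intro summable_divide summable_add) auto
  then show ?thesis
  proof (rule summable_comparison_test')
    fix n :: nat
    have pos: "Gamma (\<alpha> + 1) > 0" "Gamma (\<beta> + 1) > 0" "pochhammer (\<alpha> + 1) n > 0" "pochhammer (\<beta> + 1) n > 0"
        "Gamma (real n + \<alpha> + \<beta> + 1) > 0"
      using ab by (auto intro!: Gamma_real_pos pochhammer_pos)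
    let ?J = "\<lambda>\<theta>. jacobi_E \<alpha> \<beta> n (- (sin (\<theta> / 2))\<^sup>2) (1 - (sin (\<theta> / 2))\<^sup>2)"
    define M where "M = (jacobi_E \<alpha> \<beta> n 0 1)\<^sup>2 + (jacobi_E \<alpha> \<beta> n (-1) 0)\<^sup>2"
    define D where "D = (2 * real n + \<alpha> + \<beta> + 1) * Gamma (real n + \<alpha> + \<beta> + 1) * fact n *
     pochhammer (\<alpha> + 1) n * pochhammer (\<beta> + 1) n / ?c"
    have "D \<ge> 0" unfolding D_def using ab pos by simp
    have b: "(?J x)\<^sup>2 \<le> M" for x :: real
      by (rule order_trans[OF jacobi_E_bound[OF ab]]) (auto simp: M_def abs_square_le_1)
    have "\<bar>?J \<theta> * ?J \<phi>\<bar> \<le> M"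
    proof -
      have "\<bar>?J \<theta>\<bar> \<le> sqrt M" "\<bar>?J \<phi>\<bar> \<le> sqrt M" using b by (auto intro!: real_le_rsqrt)
      then have "\<bar>?J \<theta>\<bar> * \<bar>?J \<phi>\<bar> \<le> sqrt M * sqrt M" by (intro mult_mono) (auto simp: M_def)
      then show ?thesis by (simp add: abs_mult M_def)
    qed
    then have "D * \<bar>?J \<theta> * ?J \<phi>\<bar> \<le> D * M" using \<open>D \<ge> 0\<close> by (rule mult_left_mono)
    also have "D * M = (A \<alpha> \<beta> n + A \<beta> \<alpha> n) / ?c"
      unfolding D_def M_def A_def jacobi_E_01[OF ab'] jacobi_E_m10[OF ab']
      using pos by (simp add: field_simps power2_eq_square)
    finally have "\<bar>jacobi_trig \<alpha> \<beta> n \<theta> * jacobi_trig \<alpha> \<beta> n \<phi>\<bar> \<le> (A \<alpha> \<beta> n + A \<beta> \<alpha> n) / ?c"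
      unfolding jacobi_trig_product[OF ab' ab(3) assms(4,5)] D_def[symmetric] using \<open>D \<ge> 0\<close> by (simp add: abs_mult)
    from mult_right_mono[OF this, of "r ^ n"]
    show "norm (jacobi_trig \<alpha> \<beta> n \<theta> * jacobi_trig \<alpha> \<beta> n \<phi> * r ^ n) \<le> (A \<alpha> \<beta> n * r ^ n + A \<beta> \<alpha> n * r ^ n) / ?c"
      using r by (simp add: abs_mult algebra_simps add_divide_distrib)
  qed
qed

section \<open>Bailey's formula for the Poisson kernel\<close>

lemma sums_pochhammer_fact:
  fixes M r :: real
  assumes "\<bar>r\<bar> < 1"
  shows "(\<lambda>m. (- r) ^ m * pochhammer M m / fact m) sums (1 + r) powr (- M)"
  using gen_binomial_real[OF assms, of "- M"] by (simp add: gbinomial_pochhammer power_minus[of r] mult_ac)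

text \<open>Writing (2m + M) Gamma (m + M) as 2 Gamma (m + M + 1) - M Gamma (m + M) splits the
  series into two binomial ones, and 2 - (1 + r) = 1 - r. It is applied at r and, for absolute
  values, at -r.\<close>

lemma sums_binomial_kernel:
  fixes M r :: real
  assumes "\<bar>r\<bar> < 1" "M > 0"
  shows "(\<lambda>m. (- r) ^ m * (2 * real m + M) * Gamma (real m + M) / fact m) sums
    (Gamma (M + 1) * (1 - r) * (1 + r) powr (- (M + 1)))"
proof -
  have "(1 + r) powr (- M) = (1 + r) * (1 + r) powr (- (M + 1))"
    using assms by (simp add: powr_mult_base)
  then have v: "Gamma (M + 1) * (2 * (1 + r) powr (- (M + 1)) - (1 + r) powr (- M)) =
     Gamma (M + 1) * (1 - r) * (1 + r) powr (- (M + 1))"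
    by (simp add: algebra_simps)
  have t: "Gamma (M + 1) * (2 * ((- r) ^ m * pochhammer (M + 1) m / fact m) - (- r) ^ m * pochhammer M m / fact m)
     = (- r) ^ m * (2 * real m + M) * Gamma (real m + M) / fact m" for m
  proof -
    have *: "Gamma z * pochhammer z m = Gamma (z + real m)" if "z > 0" for z
      using pochhammer_Gamma[OF pos_notin_nonpos_Ints[OF that], of m] Gamma_real_pos[OF that] by simp
    have G: "Gamma (z + 1) = z * Gamma z" if "z > 0" for z :: real
      by (intro Gamma_plus1 pos_notin_nonpos_Ints that)
    have "Gamma (M + 1) * pochhammer (M + 1) m = (M + real m) * Gamma (M + real m)"
      using *[of "M + 1"] G[of "M + real m"] assms by (simp add: add_ac)
    moreover have "Gamma (M + 1) * pochhammer M m = M * Gamma (M + real m)"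
      using *[of M] G[of M] assms by simp
    moreover have "Gamma (M + 1) * (2 * ((- r) ^ m * pochhammer (M + 1) m / fact m) - (- r) ^ m * pochhammer M m / fact m)
      = (- r) ^ m * (2 * (Gamma (M + 1) * pochhammer (M + 1) m) - Gamma (M + 1) * pochhammer M m) / fact m"
      by (simp add: field_simps)
    ultimately show ?thesis by (simp add: algebra_simps)
  qed
  have "(\<lambda>m. Gamma (M + 1) * (2 * ((- r) ^ m * pochhammer (M + 1) m / fact m) - (- r) ^ m * pochhammer M m / fact m))
      sums (Gamma (M + 1) * (2 * (1 + r) powr (- (M + 1)) - (1 + r) powr (- M)))"
    by (intro sums_mult sums_diff sums_pochhammer_fact assms)
  then show ?thesis unfolding v t .
qed

text \<open>Since (-n)_k = (-1)^k n! / (n - k)! and n + k = (n - k) + 2k, for fixed k the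
  coefficients depend on n as in the binomial kernel with m = n - k and M = 2k + \<alpha> + \<beta>
  + 1.\<close>

lemma jacobi_coeff_triangular:
  assumes "\<alpha> + \<beta> + 1 > 0"
  shows "jacobi_coeff \<alpha> \<beta> n X Y = (\<Sum>k\<le>n. (-1) ^ (n - k) * (2 * real n + \<alpha> + \<beta> + 1) *
     Gamma (real (n - k) + (2 * real k + \<alpha> + \<beta> + 1)) / fact (n - k) * jacobi_E \<alpha> \<beta> k X Y)"
  unfolding jacobi_coeff_def jacobi_F_def sum_distrib_left
proof (rule sum.cong[OF refl])
  fix k assume "k \<in> {..n}"
  then have k: "k \<le> n" by simp
  have "real (n choose k) = (-1) ^ k * pochhammer (- real n) k / fact k"
    unfolding gbinomial_pochhammer[symmetric] by (rule binomial_gbinomial)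
  then have "pochhammer (- real n) k = (-1) ^ k * (fact k * real (n choose k))"
    by (simp add: field_simps)
  also have "fact k * real (n choose k) = fact n / fact (n - k)"
    using k by (simp add: binomial_fact)
  finally have 1: "pochhammer (- real n) k = (-1) ^ k * (fact n / fact (n - k))" .
  have 2: "(-1 :: real) ^ n * (-1) ^ k = (-1) ^ (n - k)"
  proof -
    from k obtain d where "n = k + d" using le_Suc_ex by blast
    then show ?thesis by (simp add: power_add mult_ac)
  qed
  have pos: "real n + \<alpha> + \<beta> + 1 > 0" using assms by simp
  have "Gamma (real n + \<alpha> + \<beta> + 1) * pochhammer (real n + \<alpha> + \<beta> + 1) k = Gamma (real n + \<alpha> + \<beta> + 1 + real k)"
    using pochhammer_Gamma[OF pos_notin_nonpos_Ints[OF pos], of k] Gamma_real_pos[OF pos] by simp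
  also have "real n + \<alpha> + \<beta> + 1 + real k = real (n - k) + (2 * real k + \<alpha> + \<beta> + 1)"
    using k by (simp add: of_nat_diff)
  finally have 3: "Gamma (real n + \<alpha> + \<beta> + 1) * pochhammer (real n + \<alpha> + \<beta> + 1) k = Gamma (real (n - k) + (2 * real k + \<alpha> + \<beta> + 1))" .
  show "(-1) ^ n * (2 * real n + \<alpha> + \<beta> + 1) * Gamma (real n + \<alpha> + \<beta> + 1) / fact n *
      (pochhammer (- real n) k * pochhammer (real n + \<alpha> + \<beta> + 1) k * jacobi_E \<alpha> \<beta> k X Y) =
     (-1) ^ (n - k) * (2 * real n + \<alpha> + \<beta> + 1) *
     Gamma (real (n - k) + (2 * real k + \<alpha> + \<beta> + 1)) / fact (n - k) * jacobi_E \<alpha> \<beta> k X Y"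
    unfolding 1 2[symmetric] 3[symmetric] by (simp add: mult_ac)
qed

lemma jacobi_E_nonneg:
  assumes "\<alpha> > -1" "\<beta> > -1" "X \<ge> 0" "Y \<ge> 0"
  shows "jacobi_E \<alpha> \<beta> k X Y \<ge> 0"
  unfolding jacobi_E_def using assms
  by (intro sum_nonneg divide_nonneg_nonneg mult_nonneg_nonneg less_imp_le[OF pochhammer_pos]) auto

text \<open>For small \<open>r\<close> the double series obtained from the triangular expansion of the coefficients converges
  absolutely. For larger \<open>r\<close> it does not, although both sides still converge.\<close>

lemma jacobi_generating_small:
  fixes r :: real
  assumes ab: "\<alpha> > -1" "\<beta> > -1" "\<alpha> + \<beta> + 1 > 0" and XY: "X \<ge> 0" "Y \<ge> 0"
  assumes summ: "\<And>w. 0 \<le> w \<Longrightarrow> w < 1/4 \<Longrightarrow> summable (\<lambda>k. Gamma (2 * real k + \<alpha> + \<beta> + 2) * jacobi_E \<alpha> \<beta> k X Y * w ^ k)"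
  assumes r: "0 < r" "r < 1/8"
  shows "(\<lambda>n. jacobi_coeff \<alpha> \<beta> n X Y * r ^ n) sums ((1 - r) * (1 + r) powr (- (\<alpha> + \<beta> + 2)) *
     (\<Sum>k. Gamma (2 * real k + \<alpha> + \<beta> + 2) * jacobi_E \<alpha> \<beta> k X Y * (r / (1 + r)\<^sup>2) ^ k))"
proof -
  define B where "B k = Gamma (2 * real k + \<alpha> + \<beta> + 2) * jacobi_E \<alpha> \<beta> k X Y" for k
  define M where "M k = 2 * real k + \<alpha> + \<beta> + 1" for k
  define T where "T k m = (- r) ^ m * (2 * real m + M k) * Gamma (real m + M k) / fact m * (jacobi_E \<alpha> \<beta> k X Y * r ^ k)" for k m
  have M: "M k > 0" for k using ab by (simp add: M_def)
  have E: "jacobi_E \<alpha> \<beta> k X Y \<ge> 0" for k using ab XY by (rule_tac jacobi_E_nonneg)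
  have GM: "Gamma (M k + 1) * jacobi_E \<alpha> \<beta> k X Y = B k" for k by (simp add: B_def M_def add_ac)
  have pw: "x powr (- (M k + 1)) = x powr (- (\<alpha> + \<beta> + 2)) / (x\<^sup>2) ^ k" if "x > 0" for x k
  proof -
    have "x powr (- (M k + 1)) = x powr (- (\<alpha> + \<beta> + 2)) / x powr (real (2 * k))"
      unfolding powr_diff[symmetric] by (simp add: M_def algebra_simps)
    then show ?thesis using that by (simp add: powr_realpow power_mult del: of_nat_mult)
  qed
  have pp: "1 + r > 0" "1 - r > 0" using r by auto
  have T: "T k sums ((1 - r) * (1 + r) powr (- (\<alpha> + \<beta> + 2)) * (B k * (r / (1 + r)\<^sup>2) ^ k))" for k
  proof -
    have "T k sums (Gamma (M k + 1) * (1 - r) * (1 + r) powr (- (M k + 1)) * (jacobi_E \<alpha> \<beta> k X Y * r ^ k))"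
      unfolding T_def using r M by (intro sums_mult2 sums_binomial_kernel) auto
    also have "Gamma (M k + 1) * (1 - r) * (1 + r) powr (- (M k + 1)) * (jacobi_E \<alpha> \<beta> k X Y * r ^ k) =
       (Gamma (M k + 1) * jacobi_E \<alpha> \<beta> k X Y) * ((1 - r) * (1 + r) powr (- (M k + 1)) * r ^ k)"
      by (simp only: mult_ac)
    finally show ?thesis unfolding GM pw[OF pp(1)] power_divide by (simp add: mult_ac)
  qed
  have absT: "\<bar>T k m\<bar> = r ^ m * (2 * real m + M k) * Gamma (real m + M k) / fact m * (jacobi_E \<alpha> \<beta> k X Y * r ^ k)" for k m
    unfolding T_def using r E[of k] M[of k] by (simp add: abs_mult power_abs add_nonneg_pos less_imp_le)
  have Ta: "(\<lambda>m. \<bar>T k m\<bar>) sums ((1 + r) * (1 - r) powr (- (\<alpha> + \<beta> + 2)) * (B k * (r / (1 - r)\<^sup>2) ^ k))" for k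
  proof -
    have "(\<lambda>m. \<bar>T k m\<bar>) sums (Gamma (M k + 1) * (1 + r) * (1 - r) powr (- (M k + 1)) * (jacobi_E \<alpha> \<beta> k X Y * r ^ k))"
      unfolding absT using r M sums_binomial_kernel[of "- r" "M k"] by (intro sums_mult2) auto
    also have "Gamma (M k + 1) * (1 + r) * (1 - r) powr (- (M k + 1)) * (jacobi_E \<alpha> \<beta> k X Y * r ^ k) =
       (Gamma (M k + 1) * jacobi_E \<alpha> \<beta> k X Y) * ((1 + r) * (1 - r) powr (- (M k + 1)) * r ^ k)"
      by (simp only: mult_ac)
    finally show ?thesis unfolding GM pw[OF pp(2)] power_divide by (simp add: mult_ac)
  qed
  \<comment> \<open>Taking absolute values changes the argument to r / (1 - r)^2, which is below 1/4
    only for r < 3 - 2 sqrt 2; the value 1/8 is a convenient smaller one.\<close>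
  have w: "r / (1 - r)\<^sup>2 < 1/4" "r / (1 + r)\<^sup>2 < 1/4"
  proof -
    have "(7/8)\<^sup>2 \<le> (1 - r)\<^sup>2" using r by (intro power_mono) auto
    then show "r / (1 - r)\<^sup>2 < 1/4" using r by (simp add: divide_simps power2_eq_square split: if_splits)
    have "1\<^sup>2 \<le> (1 + r)\<^sup>2" using r by (intro power_mono) auto
    then show "r / (1 + r)\<^sup>2 < 1/4" using r by (simp add: divide_simps power2_eq_square split: if_splits)
  qed
  have sB: "summable (\<lambda>k. B k * w ^ k)" if "0 \<le> w" "w < 1/4" for w
    using summ[OF that] by (simp add: B_def)
  have Bpos: "B k \<ge> 0" for k unfolding B_def using ab E by (intro mult_nonneg_nonneg less_imp_le[OF Gamma_real_pos]) auto
  have "(\<lambda>k. (1 + r) * (1 - r) powr (- (\<alpha> + \<beta> + 2)) * (B k * (r / (1 - r)\<^sup>2) ^ k)) summable_on UNIV"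
    using sB[OF _ w(1)] r Bpos by (subst summable_on_UNIV_nonneg_real_iff) (auto intro!: summable_mult)
  then have "(\<lambda>(k, m). \<bar>T k m\<bar>) summable_on Sigma UNIV (\<lambda>_. UNIV)"
    using Ta by (intro summable_on_SigmaI[where g="\<lambda>k. (1 + r) * (1 - r) powr (- (\<alpha> + \<beta> + 2)) * (B k * (r / (1 - r)\<^sup>2) ^ k)"])
      (auto intro!: norm_summable_imp_has_sum simp: sums_iff)
  then have "(\<lambda>x. norm (case x of (k, m) \<Rightarrow> T k m)) summable_on UNIV"
    by (simp add: case_prod_unfold)
  then have "(\<lambda>(k, m). T k m) summable_on UNIV"
    by (rule abs_summable_summable)
  then obtain S where S: "((\<lambda>(k, m). T k m) has_sum S) UNIV" by (auto simp: summable_on_def)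
  have "((\<lambda>k. (1 - r) * (1 + r) powr (- (\<alpha> + \<beta> + 2)) * (B k * (r / (1 + r)\<^sup>2) ^ k)) has_sum S) UNIV"
  proof (rule has_sum_SigmaD)
    show "((\<lambda>(k, m). T k m) has_sum S) (Sigma UNIV (\<lambda>_. UNIV))" using S by simp
    show "((\<lambda>m. case (k, m) of (k, m) \<Rightarrow> T k m) has_sum
        (1 - r) * (1 + r) powr (- (\<alpha> + \<beta> + 2)) * (B k * (r / (1 + r)\<^sup>2) ^ k)) UNIV" for k
      unfolding prod.case using sums_summable[OF Ta[of k]] T[of k] by (intro norm_summable_imp_has_sum) auto
  qed
  then have S1: "S = (1 - r) * (1 + r) powr (- (\<alpha> + \<beta> + 2)) * (\<Sum>k. B k * (r / (1 + r)\<^sup>2) ^ k)"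
  proof -
    assume "((\<lambda>k. (1 - r) * (1 + r) powr (- (\<alpha> + \<beta> + 2)) * (B k * (r / (1 + r)\<^sup>2) ^ k)) has_sum S) UNIV"
    from has_sum_imp_sums[OF this] show ?thesis
      using suminf_mult[OF sB[OF _ w(2)]] r by (simp add: sums_iff)
  qed
  have bij: "bij_betw (\<lambda>(n, k). (k, n - k)) (SIGMA n:UNIV. {..n}) (UNIV :: (nat \<times> nat) set)"
    by (rule bij_betw_byWitness[where f' = "\<lambda>(k, m). (k + m, k)"]) auto
  have "((\<lambda>(n, k). T k (n - k)) has_sum S) (SIGMA n:UNIV. {..n})"
    using has_sum_reindex_bij_betw[OF bij, of "\<lambda>(k, m). T k m" S] S by (simp add: case_prod_unfold)
  then have "((\<lambda>n. \<Sum>k\<le>n. T k (n - k)) has_sum S) UNIV"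
    by (rule has_sum_SigmaD) (auto intro!: has_sum_finite)
  then have "(\<lambda>n. \<Sum>k\<le>n. T k (n - k)) sums S" by (rule has_sum_imp_sums)
  also have "(\<lambda>n. \<Sum>k\<le>n. T k (n - k)) = (\<lambda>n. jacobi_coeff \<alpha> \<beta> n X Y * r ^ n)"
  proof
    fix n
    show "(\<Sum>k\<le>n. T k (n - k)) = jacobi_coeff \<alpha> \<beta> n X Y * r ^ n"
      unfolding jacobi_coeff_triangular[OF ab(3)] sum_distrib_right
    proof (rule sum.cong[OF refl])
      fix k assume "k \<in> {..n}"
      then have k: "k \<le> n" by simp
      then have "r ^ n = r ^ (n - k) * r ^ k" by (simp flip: power_add)
      moreover have "2 * real (n - k) + M k = 2 * real n + \<alpha> + \<beta> + 1" using k by (simp add: M_def of_nat_diff)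
      ultimately show "T k (n - k) = (-1) ^ (n - k) * (2 * real n + \<alpha> + \<beta> + 1) *
          Gamma (real (n - k) + (2 * real k + \<alpha> + \<beta> + 1)) / fact (n - k) * jacobi_E \<alpha> \<beta> k X Y * r ^ n"
        unfolding T_def by (simp add: M_def power_minus[of r] mult_ac)
    qed
  qed
  finally show ?thesis unfolding S1 B_def .
qed

section \<open>Analytic continuation in r\<close>

lemma power_series_real_holomorphic:
  fixes a :: "nat \<Rightarrow> real"
  assumes "\<And>r. 0 \<le> r \<Longrightarrow> r < R \<Longrightarrow> summable (\<lambda>n. a n * r ^ n)"
  shows "(\<lambda>z. \<Sum>n. complex_of_real (a n) * z ^ n) holomorphic_on ball 0 R"
proof (rule power_series_holomorphic[where a="\<lambda>n. complex_of_real (a n)"])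
  fix z :: complex assume "z \<in> ball 0 R"
  then have "norm z < R" by simp
  then obtain r where r: "norm z < r" "r < R" using dense by blast
  then have "r > 0" using norm_ge_zero[of z] by linarith
  then have "summable (\<lambda>n. complex_of_real (a n) * complex_of_real r ^ n)"
    using summable_of_real[OF assms[of r], where 'a=complex] r by simp
  then have "summable (\<lambda>n. complex_of_real (a n) * z ^ n)"
    using r \<open>r > 0\<close> by (rule_tac powser_inside) auto
  then show "(\<lambda>n. complex_of_real (a n) * (z - 0) ^ n) sums (\<Sum>n. complex_of_real (a n) * z ^ n)"
    by (simp add: summable_sums)
qed

text \<open>\<open>r \<mapsto> r / (1+r)\<^sup>2\<close> maps the unit disc onto the plane slit along \<open>[1/4, \<infinity>)\<close>; the points of the disc mapped
  into the disc of radius 1/4 form a starlike domain containing \<open>[0, 1)\<close>, through which one can continue.\<close>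

lemma slit_disc_starlike:
  assumes "norm (z :: complex) < 1" "4 * norm z < (norm (1 + z))\<^sup>2" "0 \<le> u" "u \<le> 1"
  shows "4 * norm (of_real u * z) < (norm (1 + of_real u * z))\<^sup>2"
proof (cases "u = 0")
  case False
  \<comment> \<open>Key identity: |1 + u z|^2 - 4u|z| = u (|1 + z|^2 - 4|z|) + (1 - u) (1 - u|z|^2),
    where both terms are nonnegative and the first is positive.\<close>
  have sq: "(norm (1 + of_real v * z))\<^sup>2 = 1 + 2 * v * Re z + v\<^sup>2 * (norm z)\<^sup>2" for v :: real
    unfolding cmod_power2 by (simp add: power2_eq_square algebra_simps)
  have "u * (4 * norm z) < u * (1 + 2 * Re z + (norm z)\<^sup>2)"
    using assms(2) sq[of 1] False assms by (intro mult_strict_left_mono) auto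
  moreover have "(norm z)\<^sup>2 \<le> 1\<^sup>2" using assms by (intro power_mono) auto
  then have "u * (norm z)\<^sup>2 \<le> 1 * 1" using assms by (intro mult_mono) auto
  then have "(1 - u) * (1 - u * (norm z)\<^sup>2) \<ge> 0" using assms by (intro mult_nonneg_nonneg) auto
  ultimately show ?thesis unfolding sq using assms by (simp add: norm_mult algebra_simps power2_eq_square)
qed simp

text \<open>The difference of the two sides extends holomorphically to the starlike domain
  \<open>S\<close> and vanishes on a real segment accumulating at 0, so the identity theorem
  applies. All of (0, 1) lies in \<open>S\<close>, because s / (1 + s)^2 < 1/4 amounts to (1 - s)^2
  > 0.\<close>

lemma quadratic_transform_continuation:
  fixes a b :: "nat \<Rightarrow> real" and c :: real
  assumes a: "\<And>r. 0 \<le> r \<Longrightarrow> r < 1 \<Longrightarrow> summable (\<lambda>n. a n * r ^ n)"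
    and b: "\<And>w. 0 \<le> w \<Longrightarrow> w < 1/4 \<Longrightarrow> summable (\<lambda>n. b n * w ^ n)"
    and \<delta>: "\<delta> > 0"
    and eq: "\<And>r. 0 < r \<Longrightarrow> r < \<delta> \<Longrightarrow>
      (\<Sum>n. a n * r ^ n) = (1 - r) * (1 + r) powr c * (\<Sum>n. b n * (r / (1 + r)\<^sup>2) ^ n)"
    and r: "0 < r" "r < 1"
  shows "(\<Sum>n. a n * r ^ n) = (1 - r) * (1 + r) powr c * (\<Sum>n. b n * (r / (1 + r)\<^sup>2) ^ n)"
proof -
  define f where "f z = (\<Sum>n. complex_of_real (a n) * z ^ n)" for z
  define g where "g z = (\<Sum>n. complex_of_real (b n) * z ^ n)" for z
  define h where "h z = f z - (1 - z) * (1 + z) powr of_real c * g (z / (1 + z)\<^sup>2)" for z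
  define S where "S = {z :: complex. norm z < 1 \<and> 4 * norm z < (norm (1 + z))\<^sup>2}"
  define U where "U = complex_of_real ` {0<..<min \<delta> 1}"
  have wlt: "s / (1 + s)\<^sup>2 < 1/4" if "0 < s" "s < 1" for s :: real
  proof -
    have "(1 + s)\<^sup>2 > 0" using that by simp
    moreover have "(1 - s)\<^sup>2 > 0" using that by simp
    ultimately show ?thesis by (simp add: field_simps power2_eq_square)
  qed
  have real_in_S: "complex_of_real s \<in> S" if "0 < s" "s < 1" for s
  proof -
    have "cmod (1 + of_real s) = cmod (of_real (1 + s))" by simp
    then have "cmod (1 + of_real s) = 1 + s" unfolding norm_of_real using that by simp
    moreover have "4 * s < (1 + s)\<^sup>2" using wlt[OF that] that by (simp add: divide_simps split: if_splits)
    ultimately show ?thesis using that by (simp add: S_def)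
  qed
  have f_real: "f (of_real s) = of_real (\<Sum>n. a n * s ^ n)" if "0 < s" "s < 1" for s
    unfolding f_def using suminf_of_real[OF a[of s], where 'a=complex] that by simp
  have g_real: "g (of_real s / (1 + of_real s)\<^sup>2) = of_real (\<Sum>n. b n * (s / (1 + s)\<^sup>2) ^ n)" if "0 < s" "s < 1" for s
    unfolding g_def using suminf_of_real[OF b[of "s / (1 + s)\<^sup>2"], where 'a=complex] that wlt[OF that] by simp
  have h_real: "h (of_real s) = of_real ((\<Sum>n. a n * s ^ n) - (1 - s) * (1 + s) powr c * (\<Sum>n. b n * (s / (1 + s)\<^sup>2) ^ n))"
    if "0 < s" "s < 1" for s
  proof -
    have "(1 + complex_of_real s) powr of_real c = of_real (1 + s) powr of_real c" by simp
    also have "\<dots> = of_real ((1 + s) powr c)" using that by (intro powr_of_real) auto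
    finally have "(1 + complex_of_real s) powr of_real c = of_real ((1 + s) powr c)" .
    then show ?thesis
      unfolding h_def f_real[OF that] g_real[OF that] by (simp only: of_real_diff of_real_mult of_real_1)
  qed
  have nz: "1 + z \<noteq> 0" if "z \<in> S" for z
  proof
    assume "1 + z = 0"
    then show False using that norm_ge_zero[of z] unfolding S_def mem_Collect_eq by simp
  qed
  \<comment> \<open>Re (1 + z) > 0 on \<open>S\<close>, so the principal branch of the power is
    holomorphic there.\<close>
  have slit: "1 + z \<notin> \<real>\<^sub>\<le>\<^sub>0" if "z \<in> S" for z
  proof -
    have "\<bar>Re z\<bar> < 1" using that abs_Re_le_cmod[of z] by (simp add: S_def)
    then show ?thesis by (auto simp: complex_nonpos_Reals_iff)
  qed
  have img: "z / (1 + z)\<^sup>2 \<in> ball 0 (1/4)" if "z \<in> S" for z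
    using that nz[OF that] by (simp add: S_def norm_divide norm_power field_simps)
  have "f holomorphic_on S"
    by (rule holomorphic_on_subset[of f "ball 0 1"]) (use power_series_real_holomorphic[of 1 a] a in \<open>auto simp: f_def[abs_def] S_def\<close>)
  moreover have "(g \<circ> (\<lambda>z. z / (1 + z)\<^sup>2)) holomorphic_on S"
  proof (rule holomorphic_on_compose_gen[where t="ball 0 (1/4)"])
    show "(\<lambda>z. z / (1 + z)\<^sup>2) holomorphic_on S" using nz by (intro holomorphic_intros) auto
    show "g holomorphic_on ball 0 (1/4)" using power_series_real_holomorphic[of "1/4" b] b by (auto simp: g_def[abs_def])
  qed (use img in auto)
  ultimately have "h holomorphic_on S"
    unfolding h_def o_def using slit by (intro holomorphic_intros) auto
  moreover have "open S"
    unfolding S_def by (intro open_Collect_conj open_Collect_less continuous_intros)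
  moreover have "starlike S"
    unfolding starlike_def
  proof (intro bexI ballI subsetI)
    fix z w assume z: "z \<in> S" and "w \<in> closed_segment 0 z"
    then obtain u where u: "0 \<le> u" "u \<le> 1" "w = of_real u * z"
      by (auto simp: in_segment scaleR_conv_of_real)
    have "norm w \<le> 1 * norm z" unfolding u(3) norm_mult using u by (intro mult_right_mono) auto
    then show "w \<in> S" using slit_disc_starlike[of z u] z u by (simp add: S_def)
  qed (simp add: S_def)
  then have "connected S" by (rule starlike_imp_connected)
  moreover have "U \<subseteq> S" using real_in_S by (auto simp: U_def)
  moreover have "(0 :: complex) \<in> S" by (simp add: S_def)
  moreover have "0 islimpt U"
    unfolding islimpt_approachable
  proof (intro allI impI)
    fix e :: real assume "e > 0"
    define t where "t = min e (min \<delta> 1) / 2"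
    have "t > 0" "t < e" "t < min \<delta> 1" using \<open>e > 0\<close> \<delta> by (auto simp: t_def)
    then show "\<exists>x'\<in>U. x' \<noteq> 0 \<and> dist x' 0 < e"
      by (intro bexI[of _ "of_real t"]) (auto simp: U_def)
  qed
  moreover have "h z = 0" if "z \<in> U" for z
  proof -
    from that obtain s where s: "z = of_real s" "0 < s" "s < \<delta>" "s < 1" by (auto simp: U_def)
    show ?thesis unfolding s(1) h_real[OF s(2,4)] eq[OF s(2,3)] by simp
  qed
  ultimately have "h (of_real r) = 0" using real_in_S[OF r] by (rule analytic_continuation)
  then show ?thesis unfolding h_real[OF r] by (simp only: of_real_eq_0_iff right_minus_eq)
qed

section \<open>Bounds uniform in the parameters\<close>

lemma Gamma_real_log_convex:
  fixes x y u :: real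
  assumes "x > 0" "y > 0" "0 \<le> u" "u \<le> 1"
  shows "Gamma ((1 - u) * x + u * y) \<le> Gamma x powr (1 - u) * Gamma y powr u"
proof -
  have pos: "(1 - u) * x + u * y > 0"
    using assms by (cases "u = 0") (auto intro: add_nonneg_pos)
  have G: "Gamma x > 0" "Gamma y > 0" "Gamma ((1 - u) * x + u * y) > 0"
    using assms pos by (auto intro: Gamma_real_pos)
  have "ln (Gamma ((1 - u) * x + u * y)) \<le> (1 - u) * ln (Gamma x) + u * ln (Gamma y)"
    using convex_onD[OF log_convex_Gamma_real, of u x y] assms by simp
  then have "exp (ln (Gamma ((1 - u) * x + u * y))) \<le> exp ((1 - u) * ln (Gamma x) + u * ln (Gamma y))"
    by simp
  then show ?thesis using G by (simp add: powr_def exp_add)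
qed

text \<open>The opposite inequality to log-convexity at the midpoint \<open>x + 1/4\<close>, up to a constant.\<close>

lemma Gamma_mult_le_Gamma_quarter:
  fixes x :: real
  assumes "x \<ge> 1/2"
  shows "Gamma x * Gamma (x + 1/2) \<le> 3/2 * (Gamma (x + 1/4))\<^sup>2"
proof -
  define y where "y = x + 1/4"
  define g where "g = Gamma y"
  have y: "y > 0" using assms by (simp add: y_def)
  have g: "g > 0" unfolding g_def using y by (rule Gamma_real_pos)
  have G1: "Gamma (y + 1) = y * g" unfolding g_def using y by (intro Gamma_plus1 pos_notin_nonpos_Ints)
  have split: "g powr (1 - u) * (y * g) powr u = y powr u * g" for u
  proof -
    have "g powr (1 - u) * (y * g) powr u = y powr u * (g powr (1 - u) * g powr u)"
      using y g by (simp add: powr_mult)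
    also have "g powr (1 - u) * g powr u = g" using g by (simp flip: powr_add)
    finally show ?thesis .
  qed
  \<comment> \<open>Log-convexity between y and y + 1 bounds Gamma at y + 1/4 = x + 1/2 and at y +
    3/4 = x + 1; the exponents of y in the two bounds add up to 1.\<close>
  have a: "Gamma (y + 1/4) \<le> y powr (1/4) * g"
  proof -
    have "(1 - 1/4) * y + 1/4 * (y + 1) = y + 1/4" by (simp add: field_simps)
    then show ?thesis
      using Gamma_real_log_convex[of y "y + 1" "1/4"] y split[of "1/4"] unfolding G1 g_def[symmetric] by simp
  qed
  have "Gamma (y + 3/4) \<le> y powr (3/4) * g"
  proof -
    have "(1 - 3/4) * y + 3/4 * (y + 1) = y + 3/4" by (simp add: field_simps)
    then show ?thesis
      using Gamma_real_log_convex[of y "y + 1" "3/4"] y split[of "3/4"] unfolding G1 g_def[symmetric] by simp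
  qed
  moreover have "Gamma (y + 3/4) = x * Gamma x"
    unfolding y_def using assms Gamma_plus1[OF pos_notin_nonpos_Ints, of x] by (simp add: add.commute)
  ultimately have b: "x * Gamma x \<le> y powr (3/4) * g" by simp
  have "Gamma (y + 1/4) * (x * Gamma x) \<le> (y powr (1/4) * g) * (y powr (3/4) * g)"
    using assms y g Gamma_real_pos[of x] by (intro mult_mono[OF a b] mult_nonneg_nonneg) auto
  also have "\<dots> = (y powr (1/4) * y powr (3/4)) * g\<^sup>2" by (simp add: power2_eq_square)
  also have "y powr (1/4) * y powr (3/4) = y" using y by (simp flip: powr_add)
  \<comment> \<open>The constant 3/2 is the largest value of (x + 1/4) / x for x \<ge> 1/2.\<close>
  also have "y * g\<^sup>2 \<le> (3/2 * x) * g\<^sup>2" using assms by (intro mult_right_mono) (auto simp: y_def)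
  finally have "x * (Gamma x * Gamma (x + 1/2)) \<le> x * (3/2 * g\<^sup>2)"
    by (simp add: y_def ac_simps)
  then show ?thesis using assms by (simp add: g_def y_def)
qed

lemma Gamma_legendre_duplication_real:
  fixes x :: real
  assumes "x > 0"
  shows "Gamma x * Gamma (x + 1/2) = 2 powr (1 - 2 * x) * sqrt pi * Gamma (2 * x)"
proof -
  have "complex_of_real x \<notin> \<int>\<^sub>\<le>\<^sub>0" "complex_of_real x + 1/2 \<notin> \<int>\<^sub>\<le>\<^sub>0"
    using assms by (auto elim!: nonpos_Ints_cases simp: complex_eq_iff)
  from Gamma_legendre_duplication[OF this]
  have "complex_of_real (Gamma x * Gamma (x + 1/2)) = of_real (exp ((1 - 2 * x) * ln 2) * sqrt pi * Gamma (2 * x))"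
    by (simp add: Gamma_complex_of_real[symmetric] exp_of_real[symmetric])
  then show ?thesis unfolding of_real_eq_iff by (simp add: powr_def)
qed

text \<open>With x = i + \<mu>/2 + 1/2, the point x + 1/4 is the midpoint both of i + \<mu> + 1/2
  and i + 1 and of x and x + 1/2. Log-convexity on the first pair, its approximate converse on the
  second and Legendre duplication are chained.\<close>

lemma Gamma_fact_ge:
  fixes \<mu> :: real
  assumes "\<mu> \<ge> 0"
  shows "Gamma (2 * real i + \<mu> + 1) \<le> 3 / (2 * sqrt pi) * 2 powr \<mu> * 4 ^ i * (Gamma (real i + \<mu> + 1/2) * fact i)"
proof -
  define x where "x = real i + \<mu> / 2 + 1/2"
  have x: "x \<ge> 1/2" using assms by (simp add: x_def)
  have G: "Gamma (real i + \<mu> + 1/2) > 0" "(fact i :: real) > 0" "Gamma (x + 1/4) > 0"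
    using assms x by (auto intro!: Gamma_real_pos)
  have "Gamma (x + 1/4) \<le> Gamma (real i + \<mu> + 1/2) powr (1/2) * Gamma (real i + 1) powr (1/2)"
  proof -
    have "(1 - 1/2) * (real i + \<mu> + 1/2) + 1/2 * (real i + 1) = x + 1/4" by (simp add: x_def field_simps)
    then show ?thesis
      using Gamma_real_log_convex[of "real i + \<mu> + 1/2" "real i + 1" "1/2"] assms by simp
  qed
  also have "Gamma (real i + 1) = fact i" using Gamma_fact[of i, where 'a=real] by (simp add: add_ac)
  also have "Gamma (real i + \<mu> + 1/2) powr (1/2) * fact i powr (1/2) = sqrt (Gamma (real i + \<mu> + 1/2) * fact i)"
    using G by (simp add: powr_half_sqrt real_sqrt_mult)
  finally have "(Gamma (x + 1/4))\<^sup>2 \<le> (sqrt (Gamma (real i + \<mu> + 1/2) * fact i))\<^sup>2"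
    using G by (intro power_mono) auto
  then have "(Gamma (x + 1/4))\<^sup>2 \<le> Gamma (real i + \<mu> + 1/2) * fact i" using G by simp
  then have main: "2 powr (1 - 2 * x) * sqrt pi * Gamma (2 * x) \<le> 3/2 * (Gamma (real i + \<mu> + 1/2) * fact i)"
    using Gamma_mult_le_Gamma_quarter[OF x] Gamma_legendre_duplication_real[of x] x by simp
  have pw: "2 powr (1 - 2 * x) = 1 / (2 powr \<mu> * 4 ^ i)"
  proof -
    have "2 powr (1 - 2 * x) = 2 powr (- (\<mu> + real (2 * i)))" by (simp add: x_def algebra_simps)
    also have "\<dots> = 1 / (2 powr \<mu> * 2 powr real (2 * i))" by (simp only: powr_minus powr_add) (simp add: field_simps)
    also have "2 powr real (2 * i) = (4 :: real) ^ i" by (subst powr_realpow) (auto simp: power_mult)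
    finally show ?thesis .
  qed
  have x2: "2 * x = 2 * real i + \<mu> + 1" by (simp add: x_def)
  have aux: "g \<le> 3 / (2 * s) * (k * h)" if "1 / k * s * g \<le> 3/2 * h" "k > 0" "s > 0" for k s g h :: real
    using that by (simp add: field_simps)
  show ?thesis
    using aux[OF main[unfolded pw, unfolded x2]] by (simp add: mult_ac)
qed

text \<open>\<open>e\<^bsup>-y\<^esup>\<close> times the full series is the normalised incomplete Gamma function of \<open>\<mu>\<close>, which is at most 1.\<close>

lemma sum_powr_div_Gamma_le_exp:
  fixes \<mu> y :: real
  assumes "\<mu> \<ge> 0" "y > 0"
  shows "(\<Sum>i<n. y powr (real i + \<mu>) / Gamma (real i + \<mu> + 1)) \<le> exp y"
\<comment> \<open>At \<mu> = 0 the Gamma density used below degenerates; the sum is then a partial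
  sum of the exponential series.\<close>
proof (cases "\<mu> = 0")
  case True
  have "(\<Sum>i<n. y powr (real i + \<mu>) / Gamma (real i + \<mu> + 1)) = (\<Sum>i<n. y ^ i /\<^sub>R fact i)"
    using True assms Gamma_fact[where 'a=real] by (intro sum.cong) (auto simp: powr_realpow divide_inverse add_ac)
  also have "\<dots> \<le> (\<Sum>i. y ^ i /\<^sub>R fact i)"
    using assms summable_exp_generic[of y] by (intro sum_le_suminf) auto
  finally show ?thesis by (simp add: exp_def)
next
  case False
  then have \<mu>: "\<mu> > 0" using assms by simp
  define h where "h s = exp (- s) * (\<Sum>i<n. s powr (real i + \<mu>) / Gamma (real i + \<mu> + 1))" for s
  define h' where "h' s = exp (- s) * (\<Sum>i<n. s powr (real i + \<mu> - 1) / Gamma (real i + \<mu>)) - h s" for s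
  have dh: "(h has_real_derivative h' s) (at s)" if "s > 0" for s
  proof -
    have "((\<lambda>s. s powr (real i + \<mu>) / Gamma (real i + \<mu> + 1)) has_real_derivative
        s powr (real i + \<mu> - 1) / Gamma (real i + \<mu>)) (at s)" for i
    proof -
      have "Gamma (real i + \<mu> + 1) = (real i + \<mu>) * Gamma (real i + \<mu>)"
        using \<mu> by (intro Gamma_plus1 pos_notin_nonpos_Ints) auto
      moreover have "real i + \<mu> \<noteq> 0" using \<mu> by (simp add: add_nonneg_eq_0_iff)
      moreover have "((\<lambda>s. s powr (real i + \<mu>) / Gamma (real i + \<mu> + 1)) has_real_derivative
        ((real i + \<mu>) * s powr (real i + \<mu> - 1)) / Gamma (real i + \<mu> + 1)) (at s)"
        using that by (intro DERIV_cdivide has_real_derivative_powr)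
      ultimately show ?thesis by simp
    qed
    then have "((\<lambda>s. \<Sum>i<n. s powr (real i + \<mu>) / Gamma (real i + \<mu> + 1)) has_real_derivative
        (\<Sum>i<n. s powr (real i + \<mu> - 1) / Gamma (real i + \<mu>))) (at s)"
      by (intro DERIV_sum)
    moreover have "((\<lambda>s. exp (- s)) has_real_derivative - exp (- s)) (at s)"
      by (auto intro!: derivative_eq_intros)
    ultimately show ?thesis
      unfolding h_def[abs_def] h'_def using DERIV_mult by (fastforce simp: algebra_simps)
  qed
  \<comment> \<open>Differentiating a term lowers its index by one, so the difference telescopes;
    dropping the last term leaves the density of the Gamma distribution, of total mass 1.\<close>
  have h'_le: "h' s \<le> s powr (\<mu> - 1) / exp s / Gamma \<mu>" for s
  proof -
    have "(\<Sum>i<n. s powr (real i + \<mu> - 1) / Gamma (real i + \<mu>)) \<le>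
        s powr (\<mu> - 1) / Gamma \<mu> + (\<Sum>i<n. s powr (real i + \<mu>) / Gamma (real i + \<mu> + 1))"
    proof -
      have "(\<Sum>i<n. s powr (real i + \<mu> - 1) / Gamma (real i + \<mu>)) \<le> (\<Sum>i<Suc n. s powr (real i + \<mu> - 1) / Gamma (real i + \<mu>))"
        using \<mu> by (simp add: less_imp_le Gamma_real_pos add_nonneg_pos)
      also have "\<dots> = s powr (\<mu> - 1) / Gamma \<mu> + (\<Sum>i<n. s powr (real i + \<mu>) / Gamma (real i + \<mu> + 1))"
        by (subst sum.lessThan_Suc_shift) (simp add: algebra_simps)
      finally show ?thesis .
    qed
    from mult_left_mono[OF this, of "exp (- s)"] show ?thesis
      unfolding h'_def h_def by (simp add: exp_minus field_simps)
  qed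
  \<comment> \<open>For \<mu> < 1 the derivative may be unbounded at 0, so it is used only in the
    interior.\<close>
  have "(h' has_integral (h y - h 0)) {0..y}"
  proof (rule fundamental_theorem_of_calculus_interior)
    show "continuous_on {0..y} h"
    proof -
      have "continuous_on {0..y} (\<lambda>s. s powr (real i + \<mu>))" for i
        using \<mu> by (intro continuous_on_powr') (auto intro!: continuous_intros add_nonneg_pos)
      moreover have "Gamma (real i + \<mu> + 1) \<noteq> 0" for i
        using \<mu> Gamma_real_pos[of "real i + \<mu> + 1"] by linarith
      ultimately show ?thesis
        unfolding h_def[abs_def]
        by (intro continuous_on_mult continuous_on_sum continuous_on_divide continuous_on_exp
            continuous_on_minus continuous_on_id continuous_on_const) auto
    qed
    show "(h has_vector_derivative h' s) (at s)" if "s \<in> {0<..<y}" for s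
      using dh[of s] that by (simp add: has_real_derivative_iff_has_vector_derivative)
  qed (use assms in auto)
  moreover have "h 0 = 0" using \<mu> by (simp add: h_def)
  ultimately have hy: "(h' has_integral h y) {0..y}" by simp
  have I: "((\<lambda>s. s powr (\<mu> - 1) / exp s / Gamma \<mu>) has_integral Gamma \<mu> / Gamma \<mu>) {0..}"
    using Gamma_integral_real[OF \<mu>] by (rule has_integral_divide)
  then have I': "((\<lambda>s. s powr (\<mu> - 1) / exp s / Gamma \<mu>) has_integral 1) {0..}"
    using Gamma_real_pos[OF \<mu>] by simp
  have pos: "s powr (\<mu> - 1) / exp s / Gamma \<mu> \<ge> 0" for s
    using Gamma_real_pos[OF \<mu>] by simp
  have "(\<lambda>s. s powr (\<mu> - 1) / exp s / Gamma \<mu>) absolutely_integrable_on {0..}"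
    using I' pos by (intro nonnegative_absolutely_integrable_1) auto
  then have int: "(\<lambda>s. s powr (\<mu> - 1) / exp s / Gamma \<mu>) integrable_on {0..y}"
    by (rule set_lebesgue_integral_eq_integral(1)[OF set_integrable_subset]) auto
  have "h y \<le> integral {0..y} (\<lambda>s. s powr (\<mu> - 1) / exp s / Gamma \<mu>)"
    using hy integrable_integral[OF int] h'_le by (rule has_integral_le)
  also have "\<dots> \<le> 1"
    using integrable_integral[OF int] I' pos by (intro has_integral_subset_le[of "{0..y}" "{0..}"]) auto
  finally have "exp y * h y \<le> exp y * 1" by (intro mult_left_mono) auto
  then show ?thesis
    by (simp only: h_def mult.assoc[symmetric] exp_minus_inverse mult_1_left mult_1_right)
qed

lemma sum_powr_div_Gamma_even_le_exp:
  fixes \<mu> y :: real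
  assumes "\<mu> \<ge> 0" "y > 0"
  shows "(\<Sum>i<n. y powr (2 * real i + \<mu>) / Gamma (2 * real i + \<mu> + 1)) \<le> exp y"
proof -
  define f where "f i = y powr (real i + \<mu>) / Gamma (real i + \<mu> + 1)" for i :: nat
  have "f i \<ge> 0" for i unfolding f_def using assms by (intro divide_nonneg_nonneg less_imp_le[OF Gamma_real_pos]) auto
  then have "(\<Sum>i\<in>(\<lambda>i. 2 * i) ` {..<n}. f i) \<le> (\<Sum>i<2 * n. f i)"
    by (intro sum_mono2) auto
  also have "\<dots> \<le> exp y"
    unfolding f_def using assms by (rule sum_powr_div_Gamma_le_exp)
  finally show ?thesis by (subst (asm) sum.reindex) (auto simp: f_def inj_on_def)
qed

text \<open>The Gamma factor is an Euler integral, under which the double sum factorises into two series bounded by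
  exponentials.\<close>

lemma sum_multinomial_le:
  fixes \<mu> \<nu> A B :: real
  assumes \<mu>: "\<mu> \<ge> 0" "\<nu> \<ge> 0" and A: "A > 0" "B > 0" "A + B < 1"
  shows "(\<Sum>i<n. \<Sum>j<n. Gamma (2 * real (i + j) + \<mu> + \<nu> + 1) *
     (A powr (2 * real i + \<mu>) / Gamma (2 * real i + \<mu> + 1) * (B powr (2 * real j + \<nu>) / Gamma (2 * real j + \<nu> + 1))))
     \<le> 1 / (1 - (A + B))"
proof -
  define c where "c i j = A powr (2 * real i + \<mu>) / Gamma (2 * real i + \<mu> + 1) * (B powr (2 * real j + \<nu>) / Gamma (2 * real j + \<nu> + 1))" for i j :: nat
  have "((\<lambda>s. \<Sum>i<n. \<Sum>j<n. s powr (2 * real (i + j) + \<mu> + \<nu> + 1 - 1) / exp s * c i j) has_integral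
      (\<Sum>i<n. \<Sum>j<n. Gamma (2 * real (i + j) + \<mu> + \<nu> + 1) * c i j)) {0..}"
    using \<mu> by (intro has_integral_sum has_integral_mult_left Gamma_integral_real) (auto simp: add_nonneg_pos)
  moreover have "((\<lambda>s. exp (- (1 - (A + B)) * s)) has_integral 1 / (1 - (A + B))) {0..}"
    using has_integral_exp_minus_to_infinity[of "1 - (A + B)" 0] A by simp
  moreover have "(\<Sum>i<n. \<Sum>j<n. s powr (2 * real (i + j) + \<mu> + \<nu> + 1 - 1) / exp s * c i j) \<le> exp (- (1 - (A + B)) * s)"
    if "s \<in> {0..}" for s
  \<comment> \<open>At s = 0 the left side is 0, since \<open>0 powr x\<close> is 0 even for x =
    0.\<close>
  proof (cases "s = 0")
    case False
    then have s: "s > 0" using that by simp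
    have ij: "s powr (2 * real (i + j) + \<mu> + \<nu> + 1 - 1) / exp s * c i j = exp (- s) *
       ((s * A) powr (2 * real i + \<mu>) / Gamma (2 * real i + \<mu> + 1) * ((s * B) powr (2 * real j + \<nu>) / Gamma (2 * real j + \<nu> + 1)))" for i j
    proof -
      have "s powr (2 * real (i + j) + \<mu> + \<nu> + 1 - 1) = s powr (2 * real i + \<mu>) * s powr (2 * real j + \<nu>)"
        unfolding powr_add[symmetric] by (simp add: algebra_simps)
      then show ?thesis using s A by (simp add: c_def powr_mult exp_minus divide_inverse mult_ac)
    qed
    have "(\<Sum>i<n. \<Sum>j<n. s powr (2 * real (i + j) + \<mu> + \<nu> + 1 - 1) / exp s * c i j) = exp (- s) *
       ((\<Sum>i<n. (s * A) powr (2 * real i + \<mu>) / Gamma (2 * real i + \<mu> + 1)) * (\<Sum>j<n. (s * B) powr (2 * real j + \<nu>) / Gamma (2 * real j + \<nu> + 1)))"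
      unfolding sum_product ij by (simp only: sum_distrib_left)
    also have "\<dots> \<le> exp (- s) * (exp (s * A) * exp (s * B))"
      using s A \<mu> by (intro mult_left_mono mult_mono sum_powr_div_Gamma_even_le_exp sum_nonneg divide_nonneg_nonneg
        less_imp_le[OF Gamma_real_pos]) auto
    also have "\<dots> = exp (- (1 - (A + B)) * s)" by (simp add: algebra_simps flip: exp_add)
    finally show ?thesis .
  qed simp
  ultimately show ?thesis unfolding c_def by (rule has_integral_le)
qed

section \<open>Domination of Bailey's series\<close>

lemma inverse_pochhammer_fact_le:
  fixes \<alpha> :: real
  assumes "\<alpha> \<ge> -1/2"
  shows "1 / (pochhammer (\<alpha> + 1) i * fact i) \<le>
    3 / (2 * sqrt pi) * 2 powr (\<alpha> + 1/2) * Gamma (\<alpha> + 1) * 4 ^ i / Gamma (2 * real i + (\<alpha> + 1/2) + 1)"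
proof -
  have p: "\<alpha> + 1 > 0" using assms by simp
  have "pochhammer (\<alpha> + 1) i = Gamma (\<alpha> + 1 + real i) / Gamma (\<alpha> + 1)"
    by (rule pochhammer_Gamma[OF pos_notin_nonpos_Ints[OF p]])
  then have eq: "Gamma (\<alpha> + 1) * pochhammer (\<alpha> + 1) i = Gamma (real i + (\<alpha> + 1/2) + 1/2)"
    using Gamma_real_pos[OF p] by (simp add: add_ac)
  have G: "Gamma (2 * real i + (\<alpha> + 1/2) + 1) \<le>
      3 / (2 * sqrt pi) * 2 powr (\<alpha> + 1/2) * 4 ^ i * (Gamma (\<alpha> + 1) * (pochhammer (\<alpha> + 1) i * fact i))"
    unfolding mult.assoc[symmetric, of "Gamma (\<alpha> + 1)"] eq
    by (rule Gamma_fact_ge) (use assms in simp)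
  have pos: "pochhammer (\<alpha> + 1) i > 0" "Gamma (2 * real i + (\<alpha> + 1/2) + 1) > 0"
    using p by (auto intro!: pochhammer_pos Gamma_real_pos)
  have aux: "1 / q \<le> u * g * f / G" if "G \<le> u * f * (g * q)" "q > 0" "G > 0" for q u g f G :: real
    using that by (simp add: field_simps)
  show ?thesis by (rule aux[OF G]) (use pos in simp_all)
qed

text \<open>The coefficient of w^k in Bailey's series, where w = r / (1 + r)^2 = z^2 / 4.\<close>

definition jacobi_Q :: "real \<Rightarrow> real \<Rightarrow> real \<Rightarrow> real \<Rightarrow> nat \<Rightarrow> real" where
  "jacobi_Q \<alpha> \<beta> a b k = Gamma (2 * real k + \<alpha> + \<beta> + 2) * jacobi_E \<alpha> \<beta> k (a\<^sup>2) (b\<^sup>2)"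

text \<open>The weights of the theorem enter here: with them (z a)^(2i) becomes (z a)^(2i + \<alpha>
  + 1/2), the shape matching Gamma (2i + \<alpha> + 3/2) in the duplication bound, and likewise for
  b. Each parameter costs 3 / (2 sqrt pi).\<close>

lemma sum_jacobi_Q_le:
  fixes \<alpha> \<beta> a b z :: real
  assumes ab: "\<alpha> \<ge> -1/2" "\<beta> \<ge> -1/2" and a: "a > 0" "b > 0" "z > 0" "z * (a + b) < 1"
  shows "(z * a) powr (\<alpha> + 1/2) * (z * b) powr (\<beta> + 1/2) * (\<Sum>k<n. jacobi_Q \<alpha> \<beta> a b k * (z\<^sup>2 / 4) ^ k)
    \<le> 9 / (4 * pi) * 2 powr (\<alpha> + \<beta> + 1) * Gamma (\<alpha> + 1) * Gamma (\<beta> + 1) / (1 - z * (a + b))"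
proof -
  define \<mu> \<nu> where "\<mu> = \<alpha> + 1/2" "\<nu> = \<beta> + 1/2"
  define A B where "A = z * a" "B = z * b"
  define K where "K = 9 / (4 * pi) * 2 powr (\<alpha> + \<beta> + 1) * Gamma (\<alpha> + 1) * Gamma (\<beta> + 1)"
  define F where "F \<mu> x i = x powr (2 * real i + \<mu>) / Gamma (2 * real i + \<mu> + 1)" for \<mu> x :: real and i :: nat
  have \<mu>: "\<mu> \<ge> 0" "\<nu> \<ge> 0" using ab by (auto simp: \<mu>_\<nu>_def)
  have A: "A > 0" "B > 0" "A + B < 1" using a by (auto simp: A_B_def algebra_simps)
  have Gp: "Gamma (\<alpha> + 1) > 0" "Gamma (\<beta> + 1) > 0" using ab by (auto intro: Gamma_real_pos)
  have K: "K \<ge> 0" unfolding K_def using Gp by simp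
  have K2: "K = (3 / (2 * sqrt pi) * 2 powr \<mu> * Gamma (\<alpha> + 1)) * (3 / (2 * sqrt pi) * 2 powr \<nu> * Gamma (\<beta> + 1))"
  proof -
    have "2 powr \<mu> * 2 powr \<nu> = 2 powr (\<alpha> + \<beta> + 1)"
      unfolding powr_add[symmetric] by (rule arg_cong[where f="\<lambda>x. 2 powr x"]) (simp add: \<mu>_\<nu>_def)
    then show ?thesis unfolding K_def by (simp only: flip: \<open>2 powr \<mu> * 2 powr \<nu> = 2 powr (\<alpha> + \<beta> + 1)\<close>) (simp add: field_simps)
  qed
  have half: "x powr m * (x ^ (2 * i) / (4 ^ i * (pochhammer (g + 1) i * fact i))) \<le>
      3 / (2 * sqrt pi) * 2 powr m * Gamma (g + 1) * F m x i"
    if "x > 0" "g \<ge> -1/2" "m = g + 1/2" for x g m i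
  proof -
    have xp: "x powr (2 * real i + m) = x powr m * x ^ (2 * i)"
      using powr_realpow[OF that(1), of "2 * i"] by (simp add: powr_add mult.commute)
    have "1 / (pochhammer (g + 1) i * fact i) \<le> 3 / (2 * sqrt pi) * 2 powr m * Gamma (g + 1) * 4 ^ i / Gamma (2 * real i + m + 1)"
      unfolding that(3) by (rule inverse_pochhammer_fact_le[OF that(2)])
    from mult_left_mono[OF this, of "x powr m * x ^ (2 * i) / 4 ^ i"] that(1)
    show ?thesis unfolding F_def xp by (simp add: mult_ac)
  qed
  have "A powr \<mu> * B powr \<nu> * (\<Sum>k<n. jacobi_Q \<alpha> \<beta> a b k * (z\<^sup>2 / 4) ^ k) =
     (\<Sum>k<n. \<Sum>i\<le>k. Gamma (2 * real k + \<mu> + \<nu> + 1) *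
       ((A powr \<mu> * (A ^ (2 * i) / (4 ^ i * (pochhammer (\<alpha> + 1) i * fact i)))) *
        (B powr \<nu> * (B ^ (2 * (k - i)) / (4 ^ (k - i) * (pochhammer (\<beta> + 1) (k - i) * fact (k - i)))))))"
  proof -
    have 1: "2 * real k + \<alpha> + \<beta> + 2 = 2 * real k + \<mu> + \<nu> + 1" for k by (simp add: \<mu>_\<nu>_def)
    have 2: "(z\<^sup>2 / 4) ^ k * ((a\<^sup>2) ^ i * (b\<^sup>2) ^ (k - i)) = A ^ (2 * i) / 4 ^ i * (B ^ (2 * (k - i)) / 4 ^ (k - i))" if "i \<le> k" for i k
    proof -
      from that obtain j where "k = i + j" using le_Suc_ex by blast
      then show ?thesis by (simp add: A_B_def power_mult_distrib power_add power_divide power_mult)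
    qed
    have 3: "(z\<^sup>2 / 4) ^ k * ((a\<^sup>2) ^ i * (b\<^sup>2) ^ (k - i) / (p * f * (q * g))) =
        (A ^ (2 * i) / (4 ^ i * (p * f))) * (B ^ (2 * (k - i)) / (4 ^ (k - i) * (q * g)))" if "i \<le> k" for i k and p f q g :: real
      using 2[OF that] by (simp add: divide_simps)
    show ?thesis
      unfolding jacobi_Q_def jacobi_E_def 1 sum_distrib_left sum_distrib_right
    proof (intro sum.cong refl)
      fix k i :: nat assume "i \<in> {..k}"
      then have "i \<le> k" by simp
      note e = 3[OF this, of "pochhammer (\<alpha> + 1) i" "fact i" "pochhammer (\<beta> + 1) (k - i)" "fact (k - i)"]
      from arg_cong[OF e, of "\<lambda>x. A powr \<mu> * B powr \<nu> * Gamma (2 * real k + \<mu> + \<nu> + 1) * x"]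
      show "A powr \<mu> * B powr \<nu> * (Gamma (2 * real k + \<mu> + \<nu> + 1) *
          ((a\<^sup>2) ^ i * (b\<^sup>2) ^ (k - i) / (pochhammer (\<alpha> + 1) i * fact i * (pochhammer (\<beta> + 1) (k - i) * fact (k - i)))) * (z\<^sup>2 / 4) ^ k) =
        Gamma (2 * real k + \<mu> + \<nu> + 1) *
         ((A powr \<mu> * (A ^ (2 * i) / (4 ^ i * (pochhammer (\<alpha> + 1) i * fact i)))) *
        (B powr \<nu> * (B ^ (2 * (k - i)) / (4 ^ (k - i) * (pochhammer (\<beta> + 1) (k - i) * fact (k - i))))))"
        by (simp only: mult_ac)
    qed
  qed
  also have "\<dots> \<le> (\<Sum>k<n. \<Sum>i\<le>k. Gamma (2 * real k + \<mu> + \<nu> + 1) *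
       ((3 / (2 * sqrt pi) * 2 powr \<mu> * Gamma (\<alpha> + 1) * F \<mu> A i) * (3 / (2 * sqrt pi) * 2 powr \<nu> * Gamma (\<beta> + 1) * F \<nu> B (k - i))))"
    using A ab \<mu> Gp
    by (intro sum_mono mult_left_mono mult_mono half mult_nonneg_nonneg divide_nonneg_nonneg less_imp_le[OF Gamma_real_pos]
         less_imp_le[OF pochhammer_pos])
       (auto simp: \<mu>_\<nu>_def F_def intro!: divide_nonneg_nonneg less_imp_le[OF Gamma_real_pos])
  also have "\<dots> = K * (\<Sum>k<n. \<Sum>i\<le>k. Gamma (2 * real (i + (k - i)) + \<mu> + \<nu> + 1) * (F \<mu> A i * F \<nu> B (k - i)))"
    unfolding K2 sum_distrib_left by (intro sum.cong refl) (simp add: mult_ac)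
  also have "\<dots> \<le> K * (1 / (1 - (A + B)))"
  proof (rule mult_left_mono[OF _ K])
    have "(\<Sum>k<n. \<Sum>i\<le>k. Gamma (2 * real (i + (k - i)) + \<mu> + \<nu> + 1) * (F \<mu> A i * F \<nu> B (k - i))) =
        (\<Sum>(i, j)\<in>{(i, j). i + j < n}. Gamma (2 * real (i + j) + \<mu> + \<nu> + 1) * (F \<mu> A i * F \<nu> B j))"
      by (rule sum.triangle_reindex[symmetric])
    \<comment> \<open>Nonnegative terms allow the triangle to be enlarged to a square, on which the
      Euler integral factorises.\<close>
    also have "\<dots> \<le> (\<Sum>(i, j)\<in>{..<n} \<times> {..<n}. Gamma (2 * real (i + j) + \<mu> + \<nu> + 1) * (F \<mu> A i * F \<nu> B j))"
      using \<mu> by (intro sum_mono2) (auto simp: F_def intro!: mult_nonneg_nonneg divide_nonneg_nonneg less_imp_le[OF Gamma_real_pos])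
    also have "\<dots> = (\<Sum>i<n. \<Sum>j<n. Gamma (2 * real (i + j) + \<mu> + \<nu> + 1) * (F \<mu> A i * F \<nu> B j))"
      by (rule sum.cartesian_product[symmetric])
    also have "\<dots> \<le> 1 / (1 - (A + B))"
      unfolding F_def by (rule sum_multinomial_le[OF \<mu> A])
    finally show "(\<Sum>k<n. \<Sum>i\<le>k. Gamma (2 * real (i + (k - i)) + \<mu> + \<nu> + 1) * (F \<mu> A i * F \<nu> B (k - i))) \<le> 1 / (1 - (A + B))" .
  qed
  finally have "A powr \<mu> * B powr \<nu> * (\<Sum>k<n. jacobi_Q \<alpha> \<beta> a b k * (z\<^sup>2 / 4) ^ k) \<le> K * (1 / (1 - (A + B)))" .
  then show ?thesis by (simp add: K_def A_B_def \<mu>_\<nu>_def distrib_left)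
qed

section \<open>Positivity and decay of the Poisson kernel\<close>

lemma jacobi_Q_nonneg:
  assumes "\<alpha> \<ge> -1/2" "\<beta> \<ge> -1/2"
  shows "jacobi_Q \<alpha> \<beta> a b k \<ge> 0"
  unfolding jacobi_Q_def using assms
  by (intro mult_nonneg_nonneg jacobi_E_nonneg less_imp_le[OF Gamma_real_pos]) auto

text \<open>The bound on partial sums, taken at z = 2 sqrt w and divided by the positive weight,
  already proves convergence.\<close>

lemma summable_jacobi_Q:
  fixes \<alpha> \<beta> a b z :: real
  assumes ab: "\<alpha> \<ge> -1/2" "\<beta> \<ge> -1/2" and a: "a > 0" "b > 0" "a + b \<le> 1" and w: "0 \<le> w" "w < 1/4"
  shows "summable (\<lambda>k. jacobi_Q \<alpha> \<beta> a b k * w ^ k)"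
proof (cases "w = 0")
  case True
  then show ?thesis by simp
next
  case False
  define z where "z = 2 * sqrt w"
  have z: "z > 0" "z\<^sup>2 / 4 = w" using w False by (auto simp: z_def power_mult_distrib)
  have "z\<^sup>2 < 1\<^sup>2" using z(2) w by simp
  then have "z < 1" by (rule power_less_imp_less_base) simp
  then have "z * (a + b) < 1 * 1" using a z by (intro mult_less_le_imp_less) auto
  then have za: "z * (a + b) < 1" by simp
  define p where "p = (z * a) powr (\<alpha> + 1/2) * (z * b) powr (\<beta> + 1/2)"
  have p: "p > 0" using a z by (simp add: p_def)
  show ?thesis
  proof (rule summableI_nonneg_bounded)
    show "jacobi_Q \<alpha> \<beta> a b k * w ^ k \<ge> 0" for k
      using jacobi_Q_nonneg[OF ab] w by simp
    show "(\<Sum>k<n. jacobi_Q \<alpha> \<beta> a b k * w ^ k) \<le>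
        9 / (4 * pi) * 2 powr (\<alpha> + \<beta> + 1) * Gamma (\<alpha> + 1) * Gamma (\<beta> + 1) / (1 - z * (a + b)) / p" for n
      using sum_jacobi_Q_le[OF ab a(1,2) z(1) za, of n] p unfolding z(2) p_def[symmetric] pos_le_divide_eq[OF p]
      by (simp only: mult.commute)
  qed
qed

lemma suminf_jacobi_Q_le:
  fixes \<alpha> \<beta> a b z :: real
  assumes ab: "\<alpha> \<ge> -1/2" "\<beta> \<ge> -1/2" and a: "a > 0" "b > 0" "a + b \<le> 1" and z: "0 < z" "z < 1"
  shows "(z * a) powr (\<alpha> + 1/2) * (z * b) powr (\<beta> + 1/2) * (\<Sum>k. jacobi_Q \<alpha> \<beta> a b k * (z\<^sup>2 / 4) ^ k)
    \<le> 9 / (4 * pi) * 2 powr (\<alpha> + \<beta> + 1) * Gamma (\<alpha> + 1) * Gamma (\<beta> + 1) / (1 - z * (a + b))"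
proof -
  have "z * (a + b) < 1 * 1" using a z by (intro mult_less_le_imp_less) auto
  then have za: "z * (a + b) < 1" by simp
  have "z\<^sup>2 < 1" using z by (simp add: power_less_one_iff)
  then have s: "summable (\<lambda>k. jacobi_Q \<alpha> \<beta> a b k * (z\<^sup>2 / 4) ^ k)"
    by (intro summable_jacobi_Q ab a) auto
  show ?thesis
    unfolding suminf_mult[OF s, symmetric]
    using sum_jacobi_Q_le[OF ab a(1,2) z(1) za] s
    by (intro suminf_le_const summable_mult) (simp_all add: sum_distrib_left)
qed

text \<open>With r = exp (- t), the numbers 1 + r and 1 - r are 2 exp (- t / 2) times cosh (t / 2)
  and sinh (t / 2). Thus r / (1 + r)^2 = z^2 / 4, and the exponentials cancel.\<close>

lemma jacobi_poisson_kernel_eq: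
  fixes \<alpha> \<beta> \<theta> \<phi> t :: real
  assumes ab: "\<alpha> \<ge> -1/2" "\<beta> \<ge> -1/2" "\<alpha> + \<beta> + 1 > 0"
    and \<theta>: "\<theta> \<in> {0<..<pi}" "\<phi> \<in> {0<..<pi}" and t: "t > 0"
  defines "a \<equiv> sin (\<theta> / 2) * sin (\<phi> / 2)" and "b \<equiv> cos (\<theta> / 2) * cos (\<phi> / 2)" and "z \<equiv> 1 / cosh (t / 2)"
  shows "jacobi_poisson_kernel \<alpha> \<beta> t \<theta> \<phi> = sinh (t / 2) * z * (z / 2) powr (\<alpha> + \<beta> + 1) *
     (\<Sum>k. jacobi_Q \<alpha> \<beta> a b k * (z\<^sup>2 / 4) ^ k) / (Gamma (\<alpha> + 1) * Gamma (\<beta> + 1))"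
proof -
  define r where "r = exp (- t)"
  define G where "G = Gamma (\<alpha> + 1) * Gamma (\<beta> + 1)"
  have r: "0 < r" "r < 1" using t by (auto simp: r_def)
  have ab': "\<alpha> > -1" "\<beta> > -1" using ab by auto
  have G: "G > 0" unfolding G_def using ab' by (intro mult_pos_pos Gamma_real_pos) auto
  have a: "a > 0" "b > 0"
    unfolding a_def b_def using \<theta> by (auto intro!: mult_pos_pos sin_gt_zero cos_gt_zero_pi)
  have "a + b = cos (\<theta> / 2 - \<phi> / 2)" by (simp add: a_def b_def cos_diff)
  then have a1: "a + b \<le> 1" by simp
  let ?c = "\<lambda>n. jacobi_coeff \<alpha> \<beta> n (a\<^sup>2) (b\<^sup>2)"
  have trig: "jacobi_trig \<alpha> \<beta> n \<theta> * jacobi_trig \<alpha> \<beta> n \<phi> = ?c n / G" for n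
    unfolding jacobi_trig_product_eq_coeff[OF ab' ab(3) \<theta>] a_def b_def G_def ..
  have sc: "summable (\<lambda>n. ?c n * s ^ n)" if "0 \<le> s" "s < 1" for s
    using summable_mult[OF summable_jacobi_trig_product[OF ab \<theta> that, unfolded trig], of G] G by (simp add: mult_ac)
  have main: "(\<Sum>n. ?c n * r ^ n) = (1 - r) * (1 + r) powr (- (\<alpha> + \<beta> + 2)) * (\<Sum>k. jacobi_Q \<alpha> \<beta> a b k * (r / (1 + r)\<^sup>2) ^ k)"
  proof (rule quadratic_transform_continuation[where \<delta> = "1/8"])
    show "(\<Sum>n. ?c n * s ^ n) = (1 - s) * (1 + s) powr (- (\<alpha> + \<beta> + 2)) * (\<Sum>k. jacobi_Q \<alpha> \<beta> a b k * (s / (1 + s)\<^sup>2) ^ k)"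
      if "0 < s" "s < 1/8" for s
      using jacobi_generating_small[OF ab' ab(3), of "a\<^sup>2" "b\<^sup>2" s] summable_jacobi_Q[OF ab(1,2) a a1] that
      unfolding jacobi_Q_def by (simp add: sums_iff)
  qed (use sc r summable_jacobi_Q[OF ab(1,2) a a1] in auto)
  have "jacobi_poisson_kernel \<alpha> \<beta> t \<theta> \<phi> = (\<Sum>n. (exp (- t * ((\<alpha> + \<beta> + 1) / 2)) / G) * (?c n * r ^ n))"
    unfolding jacobi_poisson_kernel_def
  proof (rule suminf_cong)
    fix n :: nat
    have "\<bar>real n + (\<alpha> + \<beta> + 1) / 2\<bar> = real n + (\<alpha> + \<beta> + 1) / 2" using ab by simp
    then have "exp (- t * \<bar>real n + (\<alpha> + \<beta> + 1) / 2\<bar>) = exp (- t * ((\<alpha> + \<beta> + 1) / 2)) * exp (real n * (- t))"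
      by (simp add: algebra_simps flip: exp_add)
    also have "exp (real n * (- t)) = r ^ n" unfolding r_def by (rule exp_of_nat_mult)
    finally show "exp (- t * \<bar>real n + (\<alpha> + \<beta> + 1) / 2\<bar>) * jacobi_trig \<alpha> \<beta> n \<theta> * jacobi_trig \<alpha> \<beta> n \<phi> =
        (exp (- t * ((\<alpha> + \<beta> + 1) / 2)) / G) * (?c n * r ^ n)"
      using trig[of n] by (simp add: mult.assoc)
  qed
  also have "\<dots> = exp (- t * ((\<alpha> + \<beta> + 1) / 2)) / G * ((1 - r) * (1 + r) powr (- (\<alpha> + \<beta> + 2)) *
      (\<Sum>k. jacobi_Q \<alpha> \<beta> a b k * (r / (1 + r)\<^sup>2) ^ k))"
    unfolding suminf_mult[OF sc[OF less_imp_le[OF r(1)] r(2)]] main ..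
  also have "r / (1 + r)\<^sup>2 = z\<^sup>2 / 4"
  proof -
    have "r = (exp (- t / 2))\<^sup>2" by (simp add: r_def power2_eq_square flip: exp_add)
    moreover have "1 + r = exp (- t / 2) * (2 * cosh (t / 2))"
      by (simp add: r_def cosh_def algebra_simps flip: exp_add)
    ultimately have "r / (1 + r)\<^sup>2 = (exp (- t / 2))\<^sup>2 / (exp (- t / 2) * (2 * cosh (t / 2)))\<^sup>2" by simp
    also have "\<dots> = z\<^sup>2 / 4" by (simp add: z_def power2_eq_square)
    finally show ?thesis .
  qed
  also have "exp (- t * ((\<alpha> + \<beta> + 1) / 2)) / G * ((1 - r) * (1 + r) powr (- (\<alpha> + \<beta> + 2)) *
      (\<Sum>k. jacobi_Q \<alpha> \<beta> a b k * (z\<^sup>2 / 4) ^ k)) =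
     (exp (- t * ((\<alpha> + \<beta> + 1) / 2)) * (1 - r) * (1 + r) powr (- (\<alpha> + \<beta> + 2))) *
      (\<Sum>k. jacobi_Q \<alpha> \<beta> a b k * (z\<^sup>2 / 4) ^ k) / G"
    by simp
  also have "exp (- t * ((\<alpha> + \<beta> + 1) / 2)) * (1 - r) * (1 + r) powr (- (\<alpha> + \<beta> + 2)) =
      sinh (t / 2) * z * (z / 2) powr (\<alpha> + \<beta> + 1)"
  proof -
    define e where "e = exp (- t / 2)"
    have e: "e > 0" by (simp add: e_def)
    have 1: "1 + r = e * (2 * cosh (t / 2))"
      by (simp add: r_def e_def cosh_def algebra_simps flip: exp_add)
    have 2: "1 - r = e * (2 * sinh (t / 2))"
      by (simp add: r_def e_def sinh_def algebra_simps flip: exp_add)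
    have c: "cosh (t / 2) > 0" by simp
    have 3: "exp (- t * ((\<alpha> + \<beta> + 1) / 2)) = e powr (\<alpha> + \<beta> + 1)"
      by (simp add: e_def powr_def algebra_simps)
    have "(1 + r) powr (- (\<alpha> + \<beta> + 2)) = 1 / ((1 + r) powr (\<alpha> + \<beta> + 1) * (1 + r))"
    proof -
      have "\<alpha> + \<beta> + 2 = (\<alpha> + \<beta> + 1) + 1" by simp
      then show ?thesis using r by (simp only: powr_minus powr_add) (simp add: divide_inverse)
    qed
    also have "(1 + r) powr (\<alpha> + \<beta> + 1) = e powr (\<alpha> + \<beta> + 1) * (2 * cosh (t / 2)) powr (\<alpha> + \<beta> + 1)"
      unfolding 1 using e by (simp add: powr_mult)
    finally have 4: "(1 + r) powr (- (\<alpha> + \<beta> + 2)) = 1 / (e powr (\<alpha> + \<beta> + 1) * (2 * cosh (t / 2)) powr (\<alpha> + \<beta> + 1) * (e * (2 * cosh (t / 2))))"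
      unfolding 1 .
    have 5: "(z / 2) powr (\<alpha> + \<beta> + 1) = 1 / (2 * cosh (t / 2)) powr (\<alpha> + \<beta> + 1)"
      unfolding z_def using c by (simp add: powr_divide mult.commute)
    have "(2 * cosh (t / 2)) powr (\<alpha> + \<beta> + 1) > 0" "e powr (\<alpha> + \<beta> + 1) > 0" using c e by auto
    then show ?thesis
      unfolding 2 3 4 5 unfolding z_def using e c by (simp add: field_simps)
  qed
  finally show ?thesis by (simp add: G_def)
qed

lemma jacobi_poisson_kernel_nonneg:
  fixes \<alpha> \<beta> \<theta> \<phi> t :: real
  assumes ab: "\<alpha> \<ge> -1/2" "\<beta> \<ge> -1/2" "\<alpha> + \<beta> + 1 > 0"
    and \<theta>: "\<theta> \<in> {0<..<pi}" "\<phi> \<in> {0<..<pi}" and t: "t > 0"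
  shows "jacobi_poisson_kernel \<alpha> \<beta> t \<theta> \<phi> \<ge> 0"
proof -
  let ?a = "sin (\<theta> / 2) * sin (\<phi> / 2)" and ?b = "cos (\<theta> / 2) * cos (\<phi> / 2)" and ?z = "1 / cosh (t / 2)"
  have a: "?a > 0" "?b > 0"
    using \<theta> by (auto intro!: mult_pos_pos sin_gt_zero cos_gt_zero_pi)
  have a1: "?a + ?b \<le> 1" using cos_le_one[of "\<theta> / 2 - \<phi> / 2"] unfolding cos_diff by linarith
  have "cosh (t / 2) > 1" using t by (simp add: cosh_real_strict_mono[of 0, simplified])
  then have "?z\<^sup>2 < 1" by (simp add: power_less_one_iff)
  then have "summable (\<lambda>k. jacobi_Q \<alpha> \<beta> ?a ?b k * (?z\<^sup>2 / 4) ^ k)"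
    by (intro summable_jacobi_Q ab a a1) auto
  then have "(\<Sum>k. jacobi_Q \<alpha> \<beta> ?a ?b k * (?z\<^sup>2 / 4) ^ k) \<ge> 0"
    using jacobi_Q_nonneg[OF ab(1,2)] by (intro suminf_nonneg) auto
  moreover have "Gamma (\<alpha> + 1) > 0" "Gamma (\<beta> + 1) > 0" using ab by (auto intro: Gamma_real_pos)
  ultimately show ?thesis
    unfolding jacobi_poisson_kernel_eq[OF assms] using t
    by (intro divide_nonneg_nonneg mult_nonneg_nonneg) auto
qed

text \<open>The power of z splits between the two weights, after which the Gamma factors and the
  power of 2 cancel and no parameter remains. The denominator comes from z (a + b) = cos ((\<theta>
  - \<phi>) / 2) / cosh (t / 2).\<close>

lemma jacobi_poisson_kernel_le:
  fixes \<alpha> \<beta> \<theta> \<phi> t :: real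
  assumes ab: "\<alpha> \<ge> -1/2" "\<beta> \<ge> -1/2" "\<alpha> + \<beta> + 1 > 0"
    and \<theta>: "\<theta> \<in> {0<..<pi}" "\<phi> \<in> {0<..<pi}" and t: "t > 0"
  shows "(sin (\<theta> / 2) * sin (\<phi> / 2)) powr (\<alpha> + 1/2) * (cos (\<theta> / 2) * cos (\<phi> / 2)) powr (\<beta> + 1/2) *
      jacobi_poisson_kernel \<alpha> \<beta> t \<theta> \<phi> \<le> 9 / (4 * pi) * sinh (t / 2) / (cosh (t / 2) - cos ((\<theta> - \<phi>) / 2))"
proof -
  define a b z where "a = sin (\<theta> / 2) * sin (\<phi> / 2)" "b = cos (\<theta> / 2) * cos (\<phi> / 2)" "z = 1 / cosh (t / 2)"
  note d = this
  define G where "G = Gamma (\<alpha> + 1) * Gamma (\<beta> + 1)"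
  define S where "S = (\<Sum>k. jacobi_Q \<alpha> \<beta> a b k * (z\<^sup>2 / 4) ^ k)"
  have G: "G > 0" unfolding G_def using ab by (intro mult_pos_pos Gamma_real_pos) auto
  have a: "a > 0" "b > 0"
    unfolding d using \<theta> by (auto intro!: mult_pos_pos sin_gt_zero cos_gt_zero_pi)
  have ab1: "a + b = cos ((\<theta> - \<phi>) / 2)" by (simp add: d cos_diff diff_divide_distrib)
  have c: "cosh (t / 2) > 1" using t by (simp add: cosh_real_strict_mono[of 0, simplified])
  then have z: "z > 0" "z < 1" by (auto simp: d)
  have "a powr (\<alpha> + 1/2) * b powr (\<beta> + 1/2) * jacobi_poisson_kernel \<alpha> \<beta> t \<theta> \<phi> =
     sinh (t / 2) * z / (G * 2 powr (\<alpha> + \<beta> + 1)) * ((z * a) powr (\<alpha> + 1/2) * (z * b) powr (\<beta> + 1/2) * S)"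
  proof -
    have "z powr (\<alpha> + 1/2) * z powr (\<beta> + 1/2) = z powr (\<alpha> + \<beta> + 1)"
      unfolding powr_add[symmetric] by (rule arg_cong[where f="\<lambda>x. z powr x"]) simp
    then have "(z / 2) powr (\<alpha> + \<beta> + 1) = z powr (\<alpha> + 1/2) * z powr (\<beta> + 1/2) / 2 powr (\<alpha> + \<beta> + 1)"
      using z by (simp add: powr_divide)
    then show ?thesis
      unfolding jacobi_poisson_kernel_eq[OF assms] d(1,2)[symmetric] d(3)[symmetric] S_def[symmetric] G_def[symmetric]
      using a z by (simp add: powr_mult mult_ac)
  qed
  also have "\<dots> \<le> sinh (t / 2) * z / (G * 2 powr (\<alpha> + \<beta> + 1)) *
     (9 / (4 * pi) * 2 powr (\<alpha> + \<beta> + 1) * Gamma (\<alpha> + 1) * Gamma (\<beta> + 1) / (1 - z * (a + b)))"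
    unfolding S_def using z a G t ab1
    by (intro mult_left_mono suminf_jacobi_Q_le ab) auto
  also have "\<dots> = 9 / (4 * pi) * (sinh (t / 2) * (z / (1 - z * (a + b))))"
  proof -
    have "9 / (4 * pi) * 2 powr (\<alpha> + \<beta> + 1) * Gamma (\<alpha> + 1) * Gamma (\<beta> + 1) = 9 / (4 * pi) * (G * 2 powr (\<alpha> + \<beta> + 1))"
      by (simp add: G_def mult_ac)
    note eq = this
    show ?thesis unfolding eq using G by (simp add: mult_ac)
  qed
  also have "z / (1 - z * (a + b)) = 1 / (cosh (t / 2) - cos ((\<theta> - \<phi>) / 2))"
  proof -
    have "cos ((\<theta> - \<phi>) / 2) \<le> 1" by simp
    then have "cosh (t / 2) - cos ((\<theta> - \<phi>) / 2) > 0" using c by linarith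
    then show ?thesis unfolding ab1 d(3) using c by (simp add: field_simps)
  qed
  finally show ?thesis unfolding d(1,2) by simp
qed

section \<open>Pointwise bounds for small and large t\<close>

lemma cosh_1_le: "cosh (1 :: real) \<le> 2 * sinh 1"
proof -
  have "exp (1::real) \<ge> 2" using exp_ge_add_one_self[of 1] by simp
  then have "exp (1::real) * exp 1 \<ge> 2 * 2" by (intro mult_mono) auto
  then show ?thesis by (simp add: sinh_def cosh_def exp_minus field_simps)
qed

text \<open>The comparison has no multiplicative loss: a constant here would later be raised to the
  power \<alpha> + \<beta> + 1 and destroy uniformity. It suffices that tanh 1 \<ge> 1/2 and, for u
  = exp (y / 2), that 3u^4 - 4u^3 + 1 = (u - 1)^2 (3u^2 + 2u + 1).\<close>

lemma cosh_ge_cosh_1_exp: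
  fixes y :: real
  assumes "y \<ge> 0"
  shows "cosh (1 + y) \<ge> cosh 1 * exp (y / 2)"
proof -
  define u where "u = exp (y / 2)"
  have u: "u > 0" "u\<^sup>2 = exp y" by (auto simp: u_def power2_eq_square simp flip: exp_add)
  have "4 * (cosh y + sinh y / 2) = 3 * u\<^sup>2 + 1 / u\<^sup>2"
    unfolding u(2) by (simp add: sinh_def cosh_def exp_minus field_simps)
  also have "3 * u\<^sup>2 + 1 / u\<^sup>2 - 4 * u = (u - 1)\<^sup>2 * (3 * u\<^sup>2 + 2 * u + 1) / u\<^sup>2"
    using u(1) by (simp add: power2_eq_square field_simps)
  then have "3 * u\<^sup>2 + 1 / u\<^sup>2 \<ge> 4 * u"
  proof -
    have "(u - 1)\<^sup>2 * (3 * u\<^sup>2 + 2 * u + 1) / u\<^sup>2 \<ge> 0"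
      using u(1) by (intro divide_nonneg_nonneg mult_nonneg_nonneg) auto
    then show ?thesis using \<open>3 * u\<^sup>2 + 1 / u\<^sup>2 - 4 * u = _\<close> by linarith
  qed
  finally have "u \<le> cosh y + sinh y / 2" by simp
  then have "cosh 1 * u \<le> cosh 1 * (cosh y + sinh y / 2)" by (intro mult_left_mono) auto
  also have "\<dots> \<le> cosh 1 * cosh y + sinh 1 * sinh y"
  proof -
    have "cosh 1 * sinh y \<le> 2 * sinh 1 * sinh y" using cosh_1_le assms by (intro mult_right_mono) auto
    then show ?thesis by (simp add: distrib_left)
  qed
  also have "\<dots> = cosh (1 + y)" by (simp add: cosh_add)
  finally show ?thesis by (simp add: u_def)
qed

lemma sinh_cosh_le:
  fixes x :: real
  assumes "0 \<le> x" "x \<le> 1/2"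
  shows "sinh x \<le> 2 * x" "cosh x \<le> 2"
proof -
  have 1: "exp x \<le> 1 + x + x\<^sup>2" using assms by (intro exp_bound) auto
  have 2: "exp (- x) \<ge> 1 - x" using exp_ge_add_one_self[of "- x"] by simp
  have 3: "exp (- x) \<le> 1" using assms by simp
  have 4: "x\<^sup>2 \<le> 1/2 * x" unfolding power2_eq_square using assms by (intro mult_right_mono) auto
  have "sinh x = (exp x - exp (- x)) / 2" "cosh x = (exp x + exp (- x)) / 2"
    by (simp_all add: sinh_def cosh_def)
  note eq = this
  show "sinh x \<le> 2 * x" unfolding eq using 1 2 4 assms by (simp add: field_simps)
  show "cosh x \<le> 2" unfolding eq using add_mono[OF 1 3] 4 assms by simp
qed

text \<open>Half-angle formulas reduce the uniform bound to 2 s / (s^2 + D) with s = sinh (t / 4),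
  comparable to t since t \<le> 2. Discarding D gives the first estimate, discarding s^2 the
  second.\<close>

lemma jacobi_poisson_kernel_le_small:
  fixes \<alpha> \<beta> \<theta> \<phi> t :: real
  assumes ab: "\<alpha> \<ge> -1/2" "\<beta> \<ge> -1/2" "\<alpha> + \<beta> + 1 > 0"
    and \<theta>: "\<theta> \<in> {0<..<pi}" "\<phi> \<in> {0<..<pi}" and t: "0 < t" "t \<le> 2"
  defines "W \<equiv> (sin (\<theta> / 2) * sin (\<phi> / 2)) powr (\<alpha> + 1/2) * (cos (\<theta> / 2) * cos (\<phi> / 2)) powr (\<beta> + 1/2) *
      jacobi_poisson_kernel \<alpha> \<beta> t \<theta> \<phi>"
  shows "W \<le> 8 / t" "W * (sin ((\<theta> - \<phi>) / 4))\<^sup>2 \<le> t"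
proof -
  define s D where "s = sinh (t / 4)" "D = (sin ((\<theta> - \<phi>) / 4))\<^sup>2"
  have s: "s \<ge> t / 4" "s \<le> t / 2" "s > 0"
    unfolding s_D_def using t sinh_cosh_le(1)[of "t / 4"] real_le_x_sinh[of "t / 4"] by (auto simp: sinh_def exp_minus)
  have D: "D \<ge> 0" by (simp add: s_D_def)
  have "cosh (t / 2) = 1 + 2 * s\<^sup>2"
    using cosh_double_cosh[of "t / 4"] cosh_square_eq[of "t / 4"] by (simp add: s_D_def)
  moreover have "cos ((\<theta> - \<phi>) / 2) = 1 - 2 * D"
  proof -
    have "(\<theta> - \<phi>) / 2 = 2 * ((\<theta> - \<phi>) / 4)" by simp
    then show ?thesis unfolding s_D_def by (simp only: cos_double_sin)
  qed
  ultimately have den: "cosh (t / 2) - cos ((\<theta> - \<phi>) / 2) = 2 * (s\<^sup>2 + D)" by simp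
  have num: "sinh (t / 2) = 2 * s * cosh (t / 4)"
    using sinh_double[of "t / 4"] by (simp add: s_D_def)
  have pos: "s\<^sup>2 + D > 0" using s D by (intro add_pos_nonneg) auto
  have pi: "9 / (4 * pi) \<le> 1" using pi_gt3 by (simp add: field_simps)
  have "W \<le> 9 / (4 * pi) * (2 * s * cosh (t / 4)) / (2 * (s\<^sup>2 + D))"
    using jacobi_poisson_kernel_le[OF ab \<theta> t(1)] unfolding W_def den num .
  also have "\<dots> = 9 / (4 * pi) * (cosh (t / 4) * (s / (s\<^sup>2 + D)))"
    using pos by (simp add: field_simps)
  also have "\<dots> \<le> 1 * (2 * (s / (s\<^sup>2 + D)))"
    using pi sinh_cosh_le(2)[of "t / 4"] t s pos by (intro mult_mono) auto
  finally have W: "W \<le> 2 * (s / (s\<^sup>2 + D))" by simp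
  have "s / (s\<^sup>2 + D) \<le> s / s\<^sup>2" using s D pos by (intro divide_left_mono mult_pos_pos) auto
  also have "\<dots> = 1 / s" using s by (simp add: power2_eq_square)
  also have "\<dots> \<le> 1 / (t / 4)" using s t by (intro divide_left_mono) auto
  finally show "W \<le> 8 / t" using W by simp
  have "W * D \<le> 2 * (s / (s\<^sup>2 + D)) * D" using W D by (intro mult_right_mono)
  also have "\<dots> = 2 * s * (D / (s\<^sup>2 + D))" by simp
  also have "\<dots> \<le> 2 * s * 1" using pos s by (intro mult_left_mono) auto
  also have "\<dots> \<le> t" using s by simp
  finally show "W * (sin ((\<theta> - \<phi>) / 4))\<^sup>2 \<le> t" by (simp add: s_D_def)
qed

text \<open>Each factor of Bailey's formula is compared with its value at t = 2: the hyperbolic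
  tangent grows by at most a factor 2, the series does not increase, and the power of z
  decays.\<close>

lemma jacobi_poisson_kernel_le_large:
  fixes \<alpha> \<beta> \<theta> \<phi> t :: real
  assumes ab: "\<alpha> \<ge> -1/2" "\<beta> \<ge> -1/2" "\<alpha> + \<beta> + 1 > 0"
    and \<theta>: "\<theta> \<in> {0<..<pi}" "\<phi> \<in> {0<..<pi}" and t: "t \<ge> 2"
  shows "(sin (\<theta> / 2) * sin (\<phi> / 2)) powr (\<alpha> + 1/2) * (cos (\<theta> / 2) * cos (\<phi> / 2)) powr (\<beta> + 1/2) *
      jacobi_poisson_kernel \<alpha> \<beta> t \<theta> \<phi> \<le> 8 * exp (- ((\<beta> + 1/2) / 4 * (t - 2)))"
proof -
  define a b where "a = sin (\<theta> / 2) * sin (\<phi> / 2)" "b = cos (\<theta> / 2) * cos (\<phi> / 2)"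
  define c where "c = a powr (\<alpha> + 1/2) * b powr (\<beta> + 1/2)"
  define z where "z s = 1 / cosh (s / 2)" for s :: real
  define R where "R s = (\<Sum>k. jacobi_Q \<alpha> \<beta> a b k * ((z s)\<^sup>2 / 4) ^ k)" for s
  define P where "P s = jacobi_poisson_kernel \<alpha> \<beta> s \<theta> \<phi>" for s
  define G where "G = Gamma (\<alpha> + 1) * Gamma (\<beta> + 1)"
  define l where "l = \<alpha> + \<beta> + 1"
  have G: "G > 0" unfolding G_def using ab by (intro mult_pos_pos Gamma_real_pos) auto
  have a: "a > 0" "b > 0"
    unfolding a_b_def using \<theta> by (auto intro!: mult_pos_pos sin_gt_zero cos_gt_zero_pi)
  have a1: "a + b \<le> 1" using cos_le_one[of "\<theta> / 2 - \<phi> / 2"] unfolding a_b_def cos_diff by linarith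
  have P: "P s = sinh (s / 2) * z s * (z s / 2) powr l * R s / G" if "s > 0" for s
    using jacobi_poisson_kernel_eq[OF ab \<theta> that] unfolding P_def R_def a_b_def z_def G_def l_def .
  have zpos: "z s > 0" for s by (simp add: z_def)
  have zless: "z s < 1" if "s > 0" for s
    using that by (simp add: z_def cosh_real_strict_mono[of 0, simplified])
  have zle: "z t \<le> z 2" unfolding z_def using t by (intro divide_left_mono) (auto simp: cosh_real_nonneg_le_iff)
  have summ: "summable (\<lambda>k. jacobi_Q \<alpha> \<beta> a b k * ((z s)\<^sup>2 / 4) ^ k)" if "s > 0" for s
    using zpos[of s] zless[OF that] by (intro summable_jacobi_Q ab a a1) (auto simp: power_less_one_iff)
  have Rle: "R t \<le> R 2"
    unfolding R_def using jacobi_Q_nonneg[OF ab(1,2)] zle zpos t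
    by (intro suminf_le summ mult_left_mono power_mono divide_right_mono) (auto simp: less_imp_le)
  have Rpos: "R s \<ge> 0" if "s > 0" for s
    unfolding R_def using jacobi_Q_nonneg[OF ab(1,2)] that by (intro suminf_nonneg summ) auto
  have "sinh (t / 2) \<le> cosh (t / 2)" by (simp add: sinh_def cosh_def)
  then have tanh: "sinh (t / 2) * z t \<le> 1" by (simp add: z_def)
  have tanh2: "1 \<le> 2 * (sinh (2 / 2) * z 2)"
    using cosh_1_le by (simp add: z_def field_simps)
  have decay: "(z t / 2) powr l \<le> (z 2 / 2) powr l * exp (- ((\<beta> + 1/2) / 4 * (t - 2)))"
  proof -
    have "cosh 1 * exp ((t / 2 - 1) / 2) \<le> cosh (1 + (t / 2 - 1))" using t by (intro cosh_ge_cosh_1_exp) auto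
    then have "z t \<le> z 2 * exp (- ((t - 2) / 4))"
      by (simp add: z_def exp_minus field_simps)
    then have "(z t / 2) powr l \<le> (z 2 / 2 * exp (- ((t - 2) / 4))) powr l"
      using zpos[of t] ab by (intro powr_mono2) (auto simp: l_def)
    also have "\<dots> = (z 2 / 2) powr l * exp (- ((t - 2) / 4) * l)"
      using zpos[of 2] by (subst powr_mult) (auto simp: exp_powr_real)
    \<comment> \<open>As \<alpha> + 1/2 \<ge> 0, \<open>l\<close> is at least \<beta> + 1/2; this
      fixes the rate.\<close>
    also have "exp (- ((t - 2) / 4) * l) \<le> exp (- ((\<beta> + 1/2) / 4 * (t - 2)))"
    proof -
      have "(\<beta> + 1/2) * (t - 2) \<le> l * (t - 2)" using ab t by (intro mult_right_mono) (auto simp: l_def)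
      then show ?thesis by (simp add: mult.commute)
    qed
    finally show ?thesis by (simp add: mult_left_mono)
  qed
  have "P t * G = (sinh (t / 2) * z t) * ((z t / 2) powr l * R t)" using P[of t] t G by simp
  also have "\<dots> \<le> (2 * (sinh (2 / 2) * z 2)) * ((z 2 / 2) powr l * exp (- ((\<beta> + 1/2) / 4 * (t - 2))) * R 2)"
  proof (rule mult_mono)
    show "(z t / 2) powr l * R t \<le> (z 2 / 2) powr l * exp (- ((\<beta> + 1/2) / 4 * (t - 2))) * R 2"
      using Rpos[of t] t by (intro mult_mono[OF decay Rle]) auto
    show "sinh (t / 2) * z t \<le> 2 * (sinh (2 / 2) * z 2)" using tanh tanh2 by linarith
    show "0 \<le> 2 * (sinh (2 / 2) * z 2)" using tanh2 by linarith
    show "0 \<le> (z t / 2) powr l * R t" using Rpos[of t] t by simp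
  qed
  also have "\<dots> = (2 * P 2 * exp (- ((\<beta> + 1/2) / 4 * (t - 2)))) * G" using P[of 2] G by (simp add: mult_ac)
  finally have "P t \<le> 2 * P 2 * exp (- ((\<beta> + 1/2) / 4 * (t - 2)))" using G by simp
  then have "c * P t \<le> c * (2 * P 2 * exp (- ((\<beta> + 1/2) / 4 * (t - 2))))"
    by (intro mult_left_mono) (simp_all add: c_def)
  also have "\<dots> = 2 * (c * P 2) * exp (- ((\<beta> + 1/2) / 4 * (t - 2)))" by simp
  \<comment> \<open>The factor 8 / 2 is the small-time bound 8 / t at t = 2.\<close>
  also have "\<dots> \<le> 2 * (8 / 2) * exp (- ((\<beta> + 1/2) / 4 * (t - 2)))"
    using jacobi_poisson_kernel_le_small(1)[OF ab \<theta>, of 2]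
    by (intro mult_right_mono mult_left_mono) (auto simp: c_def a_b_def P_def)
  finally show ?thesis by (simp add: c_def a_b_def P_def)
qed

section \<open>The fractional integral kernel\<close>

lemma nn_integral_exp_decay:
  fixes c k :: real
  assumes "c \<ge> 0" "k > 0"
  shows "(\<integral>\<^sup>+t. ennreal (c * exp (- (k * (t - 2)))) * indicator {2..} t \<partial>lborel) = ennreal (c / k)"
proof -
  have "(\<integral>\<^sup>+t. ennreal (c * exp (- (k * (t - 2)))) * indicator {2..} t \<partial>lborel)
      = ennreal (0 - (- (c / k * exp (- (k * (2 - 2))))))"
  proof (rule nn_integral_FTC_atLeast[where F = "\<lambda>t. - (c / k * exp (- (k * (t - 2))))"])
    show "DERIV (\<lambda>t. - (c / k * exp (- (k * (t - 2))))) t :> c * exp (- (k * (t - 2)))" for t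
      using assms by (auto intro!: derivative_eq_intros)
    show "((\<lambda>t. - (c / k * exp (- (k * (t - 2))))) \<longlongrightarrow> 0) at_top"
      using assms by real_asymp
  qed (use assms in auto)
  then show ?thesis by simp
qed

lemma nn_integral_powr_decay:
  fixes c \<sigma> D :: real
  assumes "c \<ge> 0" "\<sigma> < 1" "D > 0"
  shows "(\<integral>\<^sup>+t. ennreal (c * t powr (\<sigma> - 2)) * indicator {D..} t \<partial>lborel) = ennreal (c / (1 - \<sigma>) * D powr (\<sigma> - 1))"
proof -
  have "(\<integral>\<^sup>+t. ennreal (c * t powr (\<sigma> - 2)) * indicator {D..} t \<partial>lborel)
      = ennreal (0 - (- (c / (1 - \<sigma>) * D powr (\<sigma> - 1))))"
  proof (rule nn_integral_FTC_atLeast[where F = "\<lambda>t. - (c / (1 - \<sigma>) * t powr (\<sigma> - 1))"])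
    show "DERIV (\<lambda>t. - (c / (1 - \<sigma>) * t powr (\<sigma> - 1))) t :> c * t powr (\<sigma> - 2)" if "D \<le> t" for t
    proof -
      have "DERIV (\<lambda>t. - (c / (1 - \<sigma>) * t powr (\<sigma> - 1))) t :> - (c / (1 - \<sigma>) * ((\<sigma> - 1) * t powr (\<sigma> - 1 - 1)))"
        using assms that by (intro DERIV_minus DERIV_cmult has_real_derivative_powr) auto
      moreover have "- (c / (1 - \<sigma>) * ((\<sigma> - 1) * t powr (\<sigma> - 1 - 1))) = c * t powr (\<sigma> - 2)"
        using assms(2) by (simp add: field_simps)
      ultimately show ?thesis by simp
    qed
    show "((\<lambda>t. - (c / (1 - \<sigma>) * t powr (\<sigma> - 1))) \<longlongrightarrow> 0) at_top"
      using assms by real_asymp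
  qed (use assms in auto)
  then show ?thesis by simp
qed

text \<open>Positivity makes the negative part vanish, so the exceptional value of
  \<open>ext_integral\<close> cannot occur; the remaining integral is allowed to be infinite, as on
  the diagonal.\<close>

lemma jacobi_frac_kernel_eq:
  assumes ab: "\<alpha> \<ge> -1/2" "\<beta> \<ge> -1/2" "\<alpha> + \<beta> + 1 > 0"
    and \<theta>: "\<theta> \<in> {0<..<pi}" "\<phi> \<in> {0<..<pi}"
  shows "jacobi_frac_kernel \<sigma> \<alpha> \<beta> \<theta> \<phi> = ereal (1 / Gamma \<sigma>) *
     enn2ereal (\<integral>\<^sup>+t. ennreal (jacobi_poisson_kernel \<alpha> \<beta> t \<theta> \<phi> / t powr (1 - \<sigma>)) * indicator {0<..} t \<partial>lborel)"
proof -
  let ?f = "\<lambda>t. jacobi_poisson_kernel \<alpha> \<beta> t \<theta> \<phi> / t powr (1 - \<sigma>)"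
  have "(\<integral>\<^sup>+t. ennreal (- ?f t) \<partial>restrict_space lborel {0<..}) = (\<integral>\<^sup>+(t::real). 0 \<partial>restrict_space lborel {0<..})"
  proof (rule nn_integral_cong)
    fix t :: real assume "t \<in> space (restrict_space lborel {0<..})"
    then have "t > 0" by (simp add: space_restrict_space)
    then show "ennreal (- ?f t) = 0"
      using jacobi_poisson_kernel_nonneg[OF ab \<theta>] by (intro ennreal_neg) simp
  qed
  then have "(\<integral>\<^sup>+t. ennreal (- ?f t) \<partial>restrict_space lborel {0<..}) = 0" by simp
  then show ?thesis
    unfolding jacobi_frac_kernel_def ext_integral_def
    by (simp add: nn_integral_restrict_space zero_ennreal.rep_eq)
qed

lemma nn_integral_jacobi_poisson_kernel_le:
  fixes \<sigma> \<alpha> \<beta> \<theta> \<phi> :: real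
  assumes \<sigma>: "0 < \<sigma>" "\<sigma> < 1" and ab: "\<alpha> \<ge> -1/2" "\<beta> > -1/2"
    and \<theta>: "\<theta> \<in> {0<..<pi}" "\<phi> \<in> {0<..<pi}" "\<theta> \<noteq> \<phi>"
  defines "w \<equiv> (sin (\<theta> / 2) * sin (\<phi> / 2)) powr (\<alpha> + 1/2) * (cos (\<theta> / 2) * cos (\<phi> / 2)) powr (\<beta> + 1/2)"
    and "D \<equiv> \<bar>sin ((\<theta> - \<phi>) / 4)\<bar>"
  shows "(\<integral>\<^sup>+t. ennreal (jacobi_poisson_kernel \<alpha> \<beta> t \<theta> \<phi> / t powr (1 - \<sigma>)) * indicator {0<..} t \<partial>lborel) \<le>
      ennreal ((32 + 1 + 8 / (1 - \<sigma>)) / w * (1 / (\<beta> + 1/2) + 1 / D powr (1 - \<sigma>)))"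
proof -
  let ?P = "\<lambda>t. jacobi_poisson_kernel \<alpha> \<beta> t \<theta> \<phi>"
  define \<nu> where "\<nu> = \<beta> + 1/2"
  have ab': "\<alpha> \<ge> -1/2" "\<beta> \<ge> -1/2" "\<alpha> + \<beta> + 1 > 0" using ab by auto
  have \<nu>: "\<nu> > 0" using ab by (simp add: \<nu>_def)
  have w: "w > 0"
  proof -
    have "sin (\<theta> / 2) > 0" "sin (\<phi> / 2) > 0" "cos (\<theta> / 2) > 0" "cos (\<phi> / 2) > 0"
      using \<theta> by (auto intro!: sin_gt_zero cos_gt_zero_pi)
    then show ?thesis by (simp add: w_def)
  qed
  have D: "D > 0"
  proof -
    have "sin ((\<theta> - \<phi>) / 4) \<noteq> 0"
    proof
      assume "sin ((\<theta> - \<phi>) / 4) = 0"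
      moreover have "- pi < (\<theta> - \<phi>) / 4" "(\<theta> - \<phi>) / 4 < pi" using \<theta>(1,2) by auto
      ultimately have "(\<theta> - \<phi>) / 4 = 0" by (simp only: sin_eq_0_pi)
      then show False using \<theta> by simp
    qed
    then show ?thesis by (simp add: D_def)
  qed
  have split: "1 / t powr (1 - \<sigma>) = t powr (\<sigma> - 1)" "t powr (\<sigma> - 1) = t powr (\<sigma> - 2) * t" if "t > 0" for t
  proof -
    have "t powr (\<sigma> - 1) = t powr (- (1 - \<sigma>))" by simp
    also have "\<dots> = 1 / t powr (1 - \<sigma>)" by (rule powr_minus_divide)
    finally show "1 / t powr (1 - \<sigma>) = t powr (\<sigma> - 1)" ..
    have "t powr (\<sigma> - 1) = t powr ((\<sigma> - 2) + 1)" by simp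
    also have "\<dots> = t powr (\<sigma> - 2) * t" unfolding powr_add using that by simp
    finally show "t powr (\<sigma> - 1) = t powr (\<sigma> - 2) * t" .
  qed
  \<comment> \<open>The bounds t / D^2 and 8 / t change over at t = D. On [0, D] the first gives
    t^\<sigma> / D^2 \<le> D^(\<sigma> - 2), a constant; the second may be integrated to infinity at
    no harm.\<close>
  define g1 g2 g3 where "g1 = (\<lambda>t. ennreal (D powr (\<sigma> - 2) / w) * indicator {0..D} t)"
    "g2 = (\<lambda>t. ennreal (8 / w * t powr (\<sigma> - 2)) * indicator {D..} t)"
    "g3 = (\<lambda>t. ennreal (8 / w * exp (- (\<nu> / 4 * (t - 2)))) * indicator {2..} t)"
  note g = this
  have m: "g1 \<in> borel_measurable lborel" "g2 \<in> borel_measurable lborel" "g3 \<in> borel_measurable lborel"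
    unfolding g by measurable
  have pw: "ennreal (?P t / t powr (1 - \<sigma>)) * indicator {0<..} t \<le> g1 t + (g2 t + g3 t)" for t :: real
  proof (cases "t > 0")
    case t: True
    have f: "?P t / t powr (1 - \<sigma>) = (w * ?P t) * t powr (\<sigma> - 1) / w"
      using w unfolding split(1)[OF t, symmetric] by simp
    consider "t \<le> 2" "t \<le> D" | "t \<le> 2" "D \<le> t" | "2 \<le> t" by linarith
    then show ?thesis
    proof cases
      case 1
      have "(w * ?P t) * D\<^sup>2 \<le> t"
        using jacobi_poisson_kernel_le_small(2)[OF ab' \<theta>(1,2) t 1(1)] by (simp add: w_def D_def)
      then have "w * ?P t \<le> t / D\<^sup>2" using D by (simp add: pos_le_divide_eq)
      then have "(w * ?P t) * t powr (\<sigma> - 1) \<le> t / D\<^sup>2 * t powr (\<sigma> - 1)" by (rule mult_right_mono) simp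
      also have "\<dots> = t powr \<sigma> / D\<^sup>2" using t powr_add[of t "\<sigma> - 1" 1] by simp
      also have "\<dots> \<le> D powr \<sigma> / D\<^sup>2" using t 1 \<sigma> by (intro divide_right_mono powr_mono2) auto
      also have "\<dots> = D powr (\<sigma> - 2)" using D by (simp add: powr_diff)
      finally have "?P t / t powr (1 - \<sigma>) \<le> D powr (\<sigma> - 2) / w"
        unfolding f using w by (intro divide_right_mono) auto
      then have "ennreal (?P t / t powr (1 - \<sigma>)) * indicator {0<..} t \<le> g1 t"
        using 1 t by (simp add: g ennreal_leI)
      then show ?thesis by (simp add: add_increasing2)
    next
      case 2
      have "w * ?P t \<le> 8 / t"
        using jacobi_poisson_kernel_le_small(1)[OF ab' \<theta>(1,2) t 2(1)] by (simp add: w_def)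
      then have "(w * ?P t) * t powr (\<sigma> - 1) \<le> 8 / t * t powr (\<sigma> - 1)" by (rule mult_right_mono) simp
      also have "\<dots> = 8 * t powr (\<sigma> - 2)" using t by (simp add: split(2))
      finally have "?P t / t powr (1 - \<sigma>) \<le> 8 * t powr (\<sigma> - 2) / w"
        unfolding f using w by (intro divide_right_mono) auto
      then have "ennreal (?P t / t powr (1 - \<sigma>)) * indicator {0<..} t \<le> g2 t"
        using 2 t by (simp add: g ennreal_leI)
      then show ?thesis by (simp add: add_increasing add_increasing2)
    next
      case 3
      have "w * ?P t \<le> 8 * exp (- (\<nu> / 4 * (t - 2)))"
        using jacobi_poisson_kernel_le_large[OF ab' \<theta>(1,2) 3] by (simp add: w_def \<nu>_def)
      moreover have "t powr (\<sigma> - 1) \<le> 1" using powr_mono[of "\<sigma> - 1" 0 t] 3 \<sigma> by simp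
      ultimately have "(w * ?P t) * t powr (\<sigma> - 1) \<le> 8 * exp (- (\<nu> / 4 * (t - 2))) * 1"
        by (rule mult_mono) auto
      then have "?P t / t powr (1 - \<sigma>) \<le> 8 * exp (- (\<nu> / 4 * (t - 2))) / w"
        unfolding f using w by (intro divide_right_mono) auto
      then have "ennreal (?P t / t powr (1 - \<sigma>)) * indicator {0<..} t \<le> g3 t"
        using 3 t by (simp add: g ennreal_leI)
      then show ?thesis by (simp add: add_increasing)
    qed
  qed simp
  have Dp: "D powr (\<sigma> - 2) * D = D powr (\<sigma> - 1)" "D powr (\<sigma> - 1) = 1 / D powr (1 - \<sigma>)"
    using split[OF D] by simp_all
  have "(\<integral>\<^sup>+t. ennreal (?P t / t powr (1 - \<sigma>)) * indicator {0<..} t \<partial>lborel) \<le> (\<integral>\<^sup>+t. g1 t + (g2 t + g3 t) \<partial>lborel)"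
    by (intro nn_integral_mono pw)
  also have "\<dots> = (\<integral>\<^sup>+t. g1 t \<partial>lborel) + ((\<integral>\<^sup>+t. g2 t \<partial>lborel) + (\<integral>\<^sup>+t. g3 t \<partial>lborel))"
    using m by (simp add: nn_integral_add)
  also have "(\<integral>\<^sup>+t. g1 t \<partial>lborel) = ennreal (D powr (\<sigma> - 2) / w * D)"
    unfolding g using D w by (subst nn_integral_cmult_indicator) (simp_all flip: ennreal_mult'')
  also have "D powr (\<sigma> - 2) / w * D = D powr (\<sigma> - 1) / w" unfolding Dp(1)[symmetric] by simp
  also have "(\<integral>\<^sup>+t. g2 t \<partial>lborel) = ennreal (8 / w / (1 - \<sigma>) * D powr (\<sigma> - 1))"
    unfolding g using \<sigma> D w by (intro nn_integral_powr_decay) auto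
  also have "(\<integral>\<^sup>+t. g3 t \<partial>lborel) = ennreal (8 / w / (\<nu> / 4))"
    unfolding g using \<nu> w by (intro nn_integral_exp_decay) auto
  also have "ennreal (D powr (\<sigma> - 1) / w) + (ennreal (8 / w / (1 - \<sigma>) * D powr (\<sigma> - 1)) + ennreal (8 / w / (\<nu> / 4)))
      = ennreal (D powr (\<sigma> - 1) / w + (8 / w / (1 - \<sigma>) * D powr (\<sigma> - 1) + 8 / w / (\<nu> / 4)))"
    using w \<sigma> \<nu> by simp
  also have "\<dots> \<le> ennreal ((32 + 1 + 8 / (1 - \<sigma>)) / w * (1 / (\<beta> + 1/2) + 1 / D powr (1 - \<sigma>)))"
  proof (rule ennreal_leI)
    define E where "E = D powr (\<sigma> - 1)"
    have E: "E \<ge> 0" by (simp add: E_def)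
    have s: "8 / (1 - \<sigma>) \<ge> 0" using \<sigma> by simp
    \<comment> \<open>The integrals contribute E, 8 E / (1 - \<sigma>) and 8 / (\<nu> / 4) = 32 /
      \<nu>; summing the three coefficients gives a common constant.\<close>
    have "E + (8 / (1 - \<sigma>) * E + 32 / \<nu>) \<le> (32 + 1 + 8 / (1 - \<sigma>)) * (1 / \<nu> + E)"
    proof -
      have "E + (k * E + 32 * n) \<le> (32 + 1 + k) * (n + E)" if "k \<ge> 0" "n \<ge> 0" for k n :: real
        using that E mult_nonneg_nonneg[OF that] by (simp add: algebra_simps)
      from this[OF s, of "1 / \<nu>"] show ?thesis using \<nu> by simp
    qed
    then have "(E + (8 / (1 - \<sigma>) * E + 32 / \<nu>)) / w \<le> (32 + 1 + 8 / (1 - \<sigma>)) * (1 / \<nu> + E) / w"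
      using w by (intro divide_right_mono) auto
    then show "D powr (\<sigma> - 1) / w + (8 / w / (1 - \<sigma>) * D powr (\<sigma> - 1) + 8 / w / (\<nu> / 4)) \<le>
        (32 + 1 + 8 / (1 - \<sigma>)) / w * (1 / (\<beta> + 1/2) + 1 / D powr (1 - \<sigma>))"
      unfolding Dp(2)[symmetric] E_def[symmetric] \<nu>_def[symmetric] times_divide_eq_left
      by (simp add: add_divide_distrib mult_ac)
  qed
  finally show ?thesis .
qed

theorem theorem1p3:
  fixes \<sigma> :: real
  assumes "0 < \<sigma>" and "\<sigma> < 1"
  shows "\<exists>C :: real. \<forall>\<alpha> \<beta> \<theta> \<phi> :: real.
    \<alpha> \<ge> -1/2 \<longrightarrow> \<beta> > -1/2 \<longrightarrow> \<theta> \<in> {0<..<pi} \<longrightarrow> \<phi> \<in> {0<..<pi} \<longrightarrow>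
      0 \<le> jacobi_frac_kernel \<sigma> \<alpha> \<beta> \<theta> \<phi> \<and>
      jacobi_frac_kernel \<sigma> \<alpha> \<beta> \<theta> \<phi> \<le>
        (if \<theta> = \<phi> then \<infinity>
         else ereal (C / ((sin (\<theta> / 2) * sin (\<phi> / 2)) powr (\<alpha> + 1/2) *
                          (cos (\<theta> / 2) * cos (\<phi> / 2)) powr (\<beta> + 1/2)) *
                     (1 / (\<beta> + 1/2) + 1 / \<bar>sin ((\<theta> - \<phi>) / 4)\<bar> powr (1 - \<sigma>))))"
proof (intro exI allI impI conjI)
  fix \<alpha> \<beta> \<theta> \<phi> :: real
  assume ab: "\<alpha> \<ge> -1/2" "\<beta> > -1/2" and \<theta>: "\<theta> \<in> {0<..<pi}" "\<phi> \<in> {0<..<pi}"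
  then have ab': "\<alpha> \<ge> -1/2" "\<beta> \<ge> -1/2" "\<alpha> + \<beta> + 1 > 0" by auto
  let ?K = "\<integral>\<^sup>+t. ennreal (jacobi_poisson_kernel \<alpha> \<beta> t \<theta> \<phi> / t powr (1 - \<sigma>)) * indicator {0<..} t \<partial>lborel"
  have G: "1 / Gamma \<sigma> > 0" using Gamma_real_pos[OF assms(1)] by simp
  show "0 \<le> jacobi_frac_kernel \<sigma> \<alpha> \<beta> \<theta> \<phi>"
    unfolding jacobi_frac_kernel_eq[OF ab' \<theta>] using G by (intro ereal_0_le_mult) auto
  \<comment> \<open>The witness for C is fixed here as (33 + 8 / (1 - \<sigma>)) / Gamma \<sigma>,
    which involves \<sigma> alone.\<close>
  show "jacobi_frac_kernel \<sigma> \<alpha> \<beta> \<theta> \<phi> \<le>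
        (if \<theta> = \<phi> then \<infinity>
         else ereal ((1 / Gamma \<sigma> * (32 + 1 + 8 / (1 - \<sigma>))) / ((sin (\<theta> / 2) * sin (\<phi> / 2)) powr (\<alpha> + 1/2) *
                          (cos (\<theta> / 2) * cos (\<phi> / 2)) powr (\<beta> + 1/2)) *
                     (1 / (\<beta> + 1/2) + 1 / \<bar>sin ((\<theta> - \<phi>) / 4)\<bar> powr (1 - \<sigma>))))"
  proof (cases "\<theta> = \<phi>")
    case False
    define B where "B = (32 + 1 + 8 / (1 - \<sigma>)) / ((sin (\<theta> / 2) * sin (\<phi> / 2)) powr (\<alpha> + 1/2) *
                          (cos (\<theta> / 2) * cos (\<phi> / 2)) powr (\<beta> + 1/2)) *
                     (1 / (\<beta> + 1/2) + 1 / \<bar>sin ((\<theta> - \<phi>) / 4)\<bar> powr (1 - \<sigma>))"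
    have "1 / (\<beta> + 1/2) \<ge> 0" "8 / (1 - \<sigma>) \<ge> 0" using ab assms by auto
    then have "B \<ge> 0"
      unfolding B_def by (intro mult_nonneg_nonneg[of "_ / _"] divide_nonneg_nonneg[of "_ + _"] add_nonneg_nonneg[of "1 / _"]) auto
    have "?K \<le> ennreal B"
      unfolding B_def by (rule nn_integral_jacobi_poisson_kernel_le[OF assms ab \<theta> False])
    then have "enn2ereal ?K \<le> enn2ereal (ennreal B)" by (simp add: less_eq_ennreal.rep_eq)
    then have "enn2ereal ?K \<le> ereal B" using \<open>B \<ge> 0\<close> by (simp add: enn2ereal_ennreal)
    then have "ereal (1 / Gamma \<sigma>) * enn2ereal ?K \<le> ereal (1 / Gamma \<sigma>) * ereal B"
      using G by (intro ereal_mult_left_mono) auto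
    then show ?thesis
      unfolding jacobi_frac_kernel_eq[OF ab' \<theta>] using False by (simp add: B_def)
  qed simp
qed

end
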